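(* For every $\eta\in[0,1)$, there exists $b^\ast\in(0,\infty)$ such that the function $\widehat\varphi_\eta:(0,\infty)\to\mathbb R$ is non-analytic at $b^\ast$, where $$\widehat\varphi_\eta(b)=\liminf_{n\to\infty}\frac1{n^{3/2}}\log\mathbb P_{\lfloor bn^{3/2}/2\rfloor}\big(X\le\eta\,\mathbb E X\big).$$
   Context: $\mathbb P_m$ is probability for the random graph $G(n,m)$, a uniformly random graph on $n$ labeled vertices with exactly $m$ edges; $X$ is its number of triangles, and the expectation $\mathbb EX$ inside the probability is with respect to the same measure $\mathbb P_m$, $m=\lfloor bn^{3/2}/2\rfloor$. Non-analytic at a point means not real-analytic at that point. *)

theory Defs
  imports "HOL-Probability.Probability" "HOL-Library.Ramsey"
begin

text \<open>A graph on the vertex set \<open>{..<n}\<close> is identified with its set of edges, i.e. with a set of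
  two-element subsets of \<open>{..<n}\<close>.\<close>

definition graphs :: "nat \<Rightarrow> nat \<Rightarrow> nat set set set" where
  "graphs n m = {E. E \<subseteq> nsets {..<n} 2 \<and> card E = m}"

text \<open>The law of $G(n,m)$. It is meaningful only for \<open>m \<le> n choose 2\<close>; otherwise
  \<open>graphs n m\<close> is empty and the value is unspecified.\<close>

definition Gnm :: "nat \<Rightarrow> nat \<Rightarrow> nat set set pmf" where
  "Gnm n m = pmf_of_set (graphs n m)"

definition triangles :: "nat \<Rightarrow> nat set set \<Rightarrow> nat" where
  "triangles n E = card {T \<in> nsets {..<n} 3. nsets T 2 \<subseteq> E}"

definition edge_count :: "real \<Rightarrow> nat \<Rightarrow> nat" where
  "edge_count b n = nat \<lfloor>b * real n powr (3/2) / 2\<rfloor>"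

definition lower_tail_prob :: "real \<Rightarrow> nat \<Rightarrow> nat \<Rightarrow> real" where
  "lower_tail_prob \<eta> n m = measure_pmf.prob (Gnm n m)
     {E. real (triangles n E) \<le> \<eta> * measure_pmf.expectation (Gnm n m) (\<lambda>E. real (triangles n E))}"

text \<open>The logarithm of a probability, with \<open>log 0 = -\<infinity>\<close> (whereas \<open>ln 0 = 0\<close> in the library).\<close>

definition log_prob :: "real \<Rightarrow> ereal" where
  "log_prob p = (if p = 0 then -\<infinity> else ereal (ln p))"

text \<open>The lower limit as an extended real. For each fixed \<open>b\<close> the edge count exceeds
  \<open>n choose 2\<close> for at most finitely many \<open>n\<close>, so the unspecified values do not matter.\<close>

definition phi_hat_ereal :: "real \<Rightarrow> real \<Rightarrow> ereal" where
  "phi_hat_ereal \<eta> b =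
     liminf (\<lambda>n. ereal (1 / real n powr (3/2)) * log_prob (lower_tail_prob \<eta> n (edge_count b n)))"

text \<open>The real-valued function; it agrees with \<open>phi_hat_ereal\<close> wherever the latter is finite.\<close>

definition phi_hat :: "real \<Rightarrow> real \<Rightarrow> real" where
  "phi_hat \<eta> b = real_of_ereal (phi_hat_ereal \<eta> b)"

text \<open>Real-analyticity at a point: on a neighbourhood the function is the sum of a power series
  (with positive radius of convergence) centred at that point.\<close>

definition real_analytic_at :: "(real \<Rightarrow> real) \<Rightarrow> real \<Rightarrow> bool" where
  "real_analytic_at f x \<longleftrightarrow> (\<exists>F. (\<lambda>h. f (x + h)) has_fps_expansion F)"

end

theory Submission
  imports Defs "HOL-Real_Asymp.Real_Asymp"
begin

text \<open>Suppose \<open>phi_hat \<eta>\<close> were analytic on the whole half-line. For small \<open>b\<close> it equals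
  \<open>b\<^sup>3 / 6 * (\<eta> - 1 - \<eta> * ln \<eta>)\<close>, the Poisson lower tail, so it would be this cubic everywhere.
  But \<open>G(n,m)\<close> is contained in a balanced complete bipartite graph with probability at least
  \<open>4\<^sup>-\<^sup>m\<close>, so \<open>phi_hat \<eta> b\<close> is at least \<open>- b * ln 2\<close>: a contradiction for large \<open>b\<close>.

  For small \<open>b\<close>, weight every graph with \<open>m\<close> edges by \<open>(1 - s)\<^sup>X\<close> and let \<open>\<rho> m A\<close> be the probability
  that \<open>A\<close> is contained in the weighted random graph. Removing one edge \<open>e\<close> of \<open>A\<close> expresses
  \<open>\<rho> (m + 1) A\<close> by the probabilities \<open>\<rho> m B\<close>, where \<open>B\<close> is \<open>A - {e}\<close> together with some paths
  \<open>u - w - v\<close> closing triangles with \<open>e = {u, v}\<close>. In the norm \<open>sup\<^sub>A \<bar>f A\<bar> / r\<^bsup>card A\<^esup>\<close>, with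
  \<open>r\<close> a suitable multiple of the edge density, this recursion contracts for small \<open>b\<close>, so by
  induction on \<open>m\<close> the edges are nearly independent: \<open>\<rho> m A\<close> is close to \<open>q\<^bsup>card A\<^esup>\<close> with
  \<open>q = m / N\<close> for triangle-free \<open>A\<close>. Hence adding an edge multiplies \<open>E (1 - s)\<^sup>X\<close> by about
  \<open>(1 - s * q\<^sup>2)\<^sup>n\<close>, which gives the moment generating function of \<open>X\<close> and, by exponential
  tilting, its lower tail.\<close>

section \<open>Edges, links and triangles\<close>

lemma finite_edges: "finite (nsets {..<n::nat} 2)"
  by (simp add: finite_imp_finite_nsets)

lemma finite_graphs: "finite (graphs n m)"
  by (rule finite_subset[of _ "Pow (nsets {..<n} 2)"]) (auto simp: graphs_def finite_edges)

text \<open>For \<open>e = {u, v}\<close> and \<open>w\<close> outside \<open>e\<close> this is the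
  path u - w - v: if it is present, adding \<open>e\<close> creates the triangle on u, v, w.\<close>

definition link :: "nat set \<Rightarrow> nat \<Rightarrow> nat set set" where
  "link e w = (\<lambda>x. {x, w}) ` e"

definition codeg :: "nat \<Rightarrow> nat set \<Rightarrow> nat set set \<Rightarrow> nat" where
  "codeg n e G = card {w \<in> {..<n} - e. link e w \<subseteq> G}"

definition triangle_free :: "nat set set \<Rightarrow> bool" where
  "triangle_free A \<longleftrightarrow> (\<forall>x y z. x \<noteq> y \<and> y \<noteq> z \<and> x \<noteq> z \<longrightarrow> \<not> ({x, y} \<in> A \<and> {y, z} \<in> A \<and> {x, z} \<in> A))"

definition wsum :: "real \<Rightarrow> nat \<Rightarrow> nat \<Rightarrow> (nat set set \<Rightarrow> real) \<Rightarrow> real" where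
  "wsum s n m f = (\<Sum>G\<in>graphs n m. f G * (1 - s) ^ triangles n G)"

lemma nsets_3_2:
  assumes "x \<noteq> y" "y \<noteq> z" "x \<noteq> z"
  shows "nsets {x, y, z} 2 = {{x, y}, {x, z}, {y, z}}"
  using assms by (auto simp: nsets_2_eq)

lemma triangles_insert:
  assumes e: "e \<in> nsets {..<n} 2" and "e \<notin> G"
  shows "triangles n (insert e G) = triangles n G + codeg n e G"
proof -
  obtain u v where uv: "e = {u, v}" "u < n" "v < n" "u \<noteq> v"
    using e by (auto elim!: nsets2_E)
  let ?new = "(\<lambda>w. insert w e) ` {w \<in> {..<n} - e. link e w \<subseteq> G}"
  let ?old = "{T \<in> nsets {..<n} 3. nsets T 2 \<subseteq> G}"
  have fin: "finite ?old"
    by (simp add: finite_imp_finite_nsets)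
  have split: "{T \<in> nsets {..<n} 3. nsets T 2 \<subseteq> insert e G} = ?old \<union> ?new"
  proof (intro equalityI subsetI)
    fix T assume T: "T \<in> {T \<in> nsets {..<n} 3. nsets T 2 \<subseteq> insert e G}"
    show "T \<in> ?old \<union> ?new"
    proof (cases "e \<in> nsets T 2")
      case True
      then have "u \<in> T" "v \<in> T" by (auto simp: uv nsets_def)
      have "card (T - e) = 1"
        using T True by (auto simp: nsets_def card_Diff_subset)
      then obtain w where w: "T - e = {w}" by (auto simp: card_1_singleton_iff)
      then have Te: "T = insert w e" "w \<notin> e" "w < n"
        using True T by (auto simp: nsets_def)
      have "link e w \<subseteq> nsets T 2 - {e}"
        using Te by (auto simp: link_def uv doubleton_eq_iff)
      then have "link e w \<subseteq> G" using T Te(1) by blast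
      then have "T \<in> ?new" using Te by auto
      then show ?thesis by blast
    next
      case False
      with T show ?thesis by auto
    qed
  next
    fix T assume "T \<in> ?old \<union> ?new"
    then show "T \<in> {T \<in> nsets {..<n} 3. nsets T 2 \<subseteq> insert e G}"
    proof
      assume "T \<in> ?new"
      then obtain w where w: "w < n" "w \<noteq> u" "w \<noteq> v" "T = {w, u, v}" "{u, w} \<in> G" "{v, w} \<in> G"
        by (auto simp: link_def uv)
      then have "nsets T 2 = {{u, w}, {v, w}, e}"
        using nsets_3_2[of w u v] uv by (auto simp: insert_commute)
      moreover have "T \<in> nsets {..<n} 3"
        using w uv by (auto simp: nsets_def)
      ultimately show ?thesis using w by auto
    qed auto
  qed
  have disj: "?old \<inter> ?new = {}"
  proof -
    have "e \<in> nsets (insert w e) 2" for w using uv by (auto simp: nsets_def)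
    then show ?thesis using assms(2) by blast
  qed
  have inj: "inj_on (\<lambda>w. insert w e) {w \<in> {..<n} - e. link e w \<subseteq> G}"
    by (auto simp: inj_on_def)
  show ?thesis
    using fin disj card_image[OF inj] unfolding triangles_def split codeg_def
    by (subst card_Un_disjoint) simp_all
qed

text \<open>The factor gained by adding \<open>e\<close>, written as a product over the possible
  third vertices; this is the form that \<open>mean_expand\<close> multiplies out.\<close>

lemma pow_codeg:
  "(1 - s) ^ codeg n e G = (\<Prod>w\<in>{..<n} - e. 1 - s * of_bool (link e w \<subseteq> G) :: real)"
proof -
  have "(\<Prod>w\<in>{..<n} - e. 1 - s * of_bool (link e w \<subseteq> G) :: real)
      = (\<Prod>w\<in>{w\<in>{..<n} - e. link e w \<subseteq> G}. 1 - s)"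
    by (rule prod.mono_neutral_cong_right) auto
  then show ?thesis by (simp add: codeg_def)
qed

section \<open>Weighted sums over graphs and removal of one edge\<close>

lemma wsum_cong: "(\<And>G. G \<in> graphs n m \<Longrightarrow> f G = g G) \<Longrightarrow> wsum s n m f = wsum s n m g"
  by (auto simp: wsum_def intro!: sum.cong)

lemma wsum_add: "wsum s n m (\<lambda>G. f G + g G) = wsum s n m f + wsum s n m g"
  by (simp add: wsum_def sum.distrib distrib_right)

lemma wsum_diff: "wsum s n m (\<lambda>G. f G - g G) = wsum s n m f - wsum s n m g"
  by (simp add: wsum_def sum_subtractf left_diff_distrib)

lemma wsum_cmult: "wsum s n m (\<lambda>G. c * f G) = c * wsum s n m f"
  by (simp add: wsum_def sum_distrib_left mult_ac)

lemma wsum_sum: "wsum s n m (\<lambda>G. \<Sum>i\<in>I. f i G) = (\<Sum>i\<in>I. wsum s n m (f i))"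
  unfolding wsum_def by (subst sum.swap) (simp add: sum_distrib_right)

lemma wsum_mono:
  assumes "s \<le> 1" "\<And>G. G \<in> graphs n m \<Longrightarrow> f G \<le> g G"
  shows "wsum s n m f \<le> wsum s n m g"
  unfolding wsum_def using assms by (intro sum_mono mult_right_mono) auto

text \<open>Deleting \<open>e\<close> is a bijection onto the graphs without \<open>e\<close>, and
  \<open>triangles_insert\<close> gives the change of weight. Every recursion in the number of edges
  starts here.\<close>

lemma wsum_insert:
  assumes e: "e \<in> nsets {..<n} 2" and eB: "e \<notin> B"
  shows "wsum s n (Suc m) (\<lambda>G. of_bool (insert e B \<subseteq> G))
       = wsum s n m (\<lambda>G. of_bool (B \<subseteq> G \<and> e \<notin> G) * (1 - s) ^ codeg n e G)"
proof -
  have fin: "finite G" if "G \<in> graphs n k" for G k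
    using that finite_edges by (auto simp: graphs_def intro: finite_subset)
  have "wsum s n (Suc m) (\<lambda>G. of_bool (insert e B \<subseteq> G))
      = (\<Sum>G\<in>{G\<in>graphs n (Suc m). insert e B \<subseteq> G}. (1 - s) ^ triangles n G)"
    unfolding wsum_def by (rule sum.mono_neutral_cong_right) (auto simp: finite_graphs)
  also have "\<dots> = (\<Sum>G\<in>{G\<in>graphs n m. B \<subseteq> G \<and> e \<notin> G}. (1 - s) ^ triangles n (insert e G))"
  proof (rule sum.reindex_bij_witness[where i = "insert e" and j = "\<lambda>G. G - {e}"], goal_cases)
    case (2 G)
    then show ?case using fin[of G] eB by (auto simp: graphs_def)
  next
    case (4 G)
    then show ?case using fin[of G] e by (auto simp: graphs_def)
  qed (auto simp: insert_absorb)
  also have "\<dots> = (\<Sum>G\<in>{G\<in>graphs n m. B \<subseteq> G \<and> e \<notin> G}. (1 - s) ^ codeg n e G * (1 - s) ^ triangles n G)"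
    by (rule sum.cong) (auto simp: triangles_insert[OF e] power_add)
  also have "\<dots> = wsum s n m (\<lambda>G. of_bool (B \<subseteq> G \<and> e \<notin> G) * (1 - s) ^ codeg n e G)"
    unfolding wsum_def by (rule sum.mono_neutral_cong_left) (auto simp: finite_graphs)
  finally show ?thesis .
qed

text \<open>Double counting of pairs of a graph and one of its edges.\<close>

lemma sum_wsum_edges:
  "(\<Sum>e\<in>nsets {..<n} 2. wsum s n m (\<lambda>G. of_bool (e \<in> G))) = real m * wsum s n m (\<lambda>_. 1)"
proof -
  have "(\<Sum>e\<in>nsets {..<n} 2. of_bool (e \<in> G)) = real m" if "G \<in> graphs n m" for G
  proof -
    have "(\<Sum>e\<in>nsets {..<n} 2. of_bool (e \<in> G)) = (\<Sum>e\<in>G. 1 :: real)"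
      using that by (intro sum.mono_neutral_cong_right) (auto simp: graphs_def finite_edges)
    then show ?thesis using that by (simp add: graphs_def)
  qed
  then have "wsum s n m (\<lambda>G. \<Sum>e\<in>nsets {..<n} 2. of_bool (e \<in> G)) = wsum s n m (\<lambda>_. real m * 1)"
    by (intro wsum_cong) simp
  then show ?thesis by (simp only: wsum_sum wsum_cmult)
qed

section \<open>Edge sets enlarged by links\<close>

lemma link_disjoint:
  assumes "w \<noteq> w'" "w \<notin> e" "w' \<notin> e"
  shows "link e w \<inter> link e w' = {}"
  using assms by (auto simp: link_def doubleton_eq_iff)

lemma card_link:
  assumes "e \<in> nsets {..<n} 2" "w \<notin> e"
  shows "card (link e w) = 2"
proof -
  have "inj_on (\<lambda>x. {x, w}) e" by (auto simp: inj_on_def doubleton_eq_iff)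
  then show ?thesis using assms by (auto simp: link_def card_image nsets_def)
qed

lemma link_edges:
  assumes "e \<in> nsets {..<n} 2" "w < n" "w \<notin> e"
  shows "link e w \<subseteq> nsets {..<n} 2"
  using assms by (auto simp: link_def nsets_def card_2_iff)

text \<open>In \<open>Y_approx\<close> this makes \<open>B \<union> link e w\<close> strictly larger
  than \<open>B\<close>, which gains a further factor \<open>a\<close>.\<close>

lemma triangle_free_link:
  assumes "triangle_free (insert e B)" and e: "e \<in> nsets {..<n} 2" and "w \<notin> e"
  shows "\<not> link e w \<subseteq> B"
proof
  assume *: "link e w \<subseteq> B"
  obtain u v where uv: "e = {u, v}" "u \<noteq> v" using e by (auto elim!: nsets2_E)
  then have "{u, w} \<in> B" "{v, w} \<in> B" "u \<noteq> w" "v \<noteq> w" using * assms(3) by (auto simp: link_def)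
  then show False using assms(1) uv unfolding triangle_free_def by blast
qed

text \<open>Links of distinct new vertices are disjoint from each other and from \<open>B\<close>.
  In \<open>Y_approx\<close> each vertex of \<open>J\<close> therefore contributes exactly a factor
  \<open>(q m)\<^sup>2\<close>.\<close>

lemma card_Un_links:
  assumes e: "e \<in> nsets {..<n} 2" and J: "finite J" "J \<inter> (e \<union> \<Union>B) = {}" and B: "finite B"
  shows "card (B \<union> (\<Union>w\<in>J. link e w)) = card B + 2 * card J"
proof -
  have fin: "finite (link e w)" for w using e by (auto simp: link_def nsets_def)
  have "card (\<Union>w\<in>J. link e w) = (\<Sum>w\<in>J. card (link e w))"
    using J by (intro card_UN_disjoint ballI impI link_disjoint) (auto simp: fin)
  also have "\<dots> = (\<Sum>w\<in>J. 2)"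
    using J by (intro sum.cong card_link[OF e]) auto
  finally have "card (\<Union>w\<in>J. link e w) = 2 * card J" by simp
  moreover have "B \<inter> (\<Union>w\<in>J. link e w) = {}"
    using J by (auto simp: link_def)
  ultimately show ?thesis
    using J B fin by (subst card_Un_disjoint) auto
qed

text \<open>This keeps the recursion inside the triangle-free sets. A vertex of \<open>J\<close>
  meets only link edges, so its neighbours lie in \<open>e\<close>; a triangle through it would have
  \<open>e\<close> as its third edge, but \<open>e\<close> is neither in \<open>B\<close> nor in a
  link.\<close>

lemma triangle_free_Un_links:
  assumes e: "e \<in> nsets {..<n} 2" "e \<notin> B" and tf: "triangle_free B" and J: "J \<inter> (e \<union> \<Union>B) = {}"
  shows "triangle_free (B \<union> (\<Union>w\<in>J. link e w))"
proof -
  let ?A = "B \<union> (\<Union>w\<in>J. link e w)"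
  have linkD: "\<exists>w\<in>J. \<exists>p\<in>e. c = {p, w}" if "c \<in> ?A" "c \<inter> J \<noteq> {}" for c
    using that J by (auto simp: link_def)
  have in_link: "y \<in> e" if "{y, z} \<in> ?A" "z \<in> J" "y \<noteq> z" for y z
  proof -
    obtain w p where wp: "w \<in> J" "p \<in> e" "{y, z} = {p, w}" using linkD[of "{y, z}"] \<open>{y, z} \<in> ?A\<close> \<open>z \<in> J\<close> by blast
    then have "p \<noteq> z" using J \<open>z \<in> J\<close> by blast
    then show ?thesis using wp by (metis doubleton_eq_iff)
  qed
  have in_B: "{x, y} \<in> B" if "{x, y} \<in> ?A" "x \<notin> J" "y \<notin> J" for x y
    using that by (auto simp: link_def doubleton_eq_iff)
  have no: False if h: "{x, y} \<in> ?A" "{y, z} \<in> ?A" "{x, z} \<in> ?A" "x \<noteq> y" "y \<noteq> z" "x \<noteq> z" "z \<in> J" for x y z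
  proof -
    have xy: "x \<in> e" "y \<in> e" using in_link h by blast+
    then have "e = {x, y}" using e h by (auto simp: nsets_2_eq)
    then have "e \<in> (\<Union>w\<in>J. link e w)" using h e by blast
    then obtain w where "w \<in> J" "w \<in> e" by (auto simp: link_def)
    then show False using J by blast
  qed
  show ?thesis unfolding triangle_free_def
  proof (intro allI impI notI)
    fix x y z assume d: "x \<noteq> y \<and> y \<noteq> z \<and> x \<noteq> z" and h: "{x, y} \<in> ?A \<and> {y, z} \<in> ?A \<and> {x, z} \<in> ?A"
    consider "z \<in> J" | "y \<in> J" | "x \<in> J" | "x \<notin> J" "y \<notin> J" "z \<notin> J" by blast
    then show False
    proof cases
      case 1 then show ?thesis using no[of x y z] d h by blast
    next
      case 2 then show ?thesis using no[of x z y] d h by (metis insert_commute)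
    next
      case 3 then show ?thesis using no[of y z x] d h by (metis insert_commute)
    next
      case 4 then show ?thesis using in_B d h tf unfolding triangle_free_def by blast
    qed
  qed
qed

section \<open>Correlations in the tilted random graph\<close>

lemma sum_Pow_power_card:
  assumes "finite U"
  shows "(\<Sum>J\<in>Pow U. x ^ card J) = (1 + x :: real) ^ card U"
  using prod_add[OF assms, of "\<lambda>_. x" "\<lambda>_. 1"] by (simp add: add.commute)

lemma prod_in_unit_interval:
  fixes f :: "'a \<Rightarrow> real"
  assumes "\<And>x. x \<in> A \<Longrightarrow> 0 \<le> f x \<and> f x \<le> 1"
  shows "0 \<le> prod f A" "prod f A \<le> 1"
  using assms by (auto intro: prod_nonneg prod_le_1)

locale tilted_graphs =
  fixes s :: real and n :: nat
  assumes s: "0 \<le> s" "s \<le> 1" and n: "2 \<le> n"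
begin

abbreviation K :: "nat set set" where "K \<equiv> nsets {..<n} 2"

definition N :: real where "N = real (card K)"

definition Z :: "nat \<Rightarrow> real" where "Z m = wsum s n m (\<lambda>_. 1)"

definition mean :: "nat \<Rightarrow> (nat set set \<Rightarrow> real) \<Rightarrow> real" where
  "mean m f = wsum s n m f / Z m"

definition \<rho> :: "nat \<Rightarrow> nat set set \<Rightarrow> real" where
  "\<rho> m A = mean m (\<lambda>G. of_bool (A \<subseteq> G))"

definition q :: "nat \<Rightarrow> real" where "q m = real m / N"

text \<open>By \<open>wsum_insert\<close>, if \<open>Z m > 0\<close>, \<open>e \<in> K\<close> and
  \<open>e \<notin> B\<close>, then \<open>Z m * Y m B e\<close> is the total weight of the graphs
  with \<open>m + 1\<close> edges that contain \<open>insert e B\<close>.\<close>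

definition Y :: "nat \<Rightarrow> nat set set \<Rightarrow> nat set \<Rightarrow> real" where
  "Y m B e = mean m (\<lambda>G. of_bool (B \<subseteq> G \<and> e \<notin> G) * (1 - s) ^ codeg n e G)"

text \<open>By averaging over \<open>e\<close>, no symmetry of the weights under relabelling the vertices is needed.\<close>

definition Q :: "nat \<Rightarrow> real" where "Q m = (\<Sum>e\<in>K. Y m {} e) / N"

lemma N_pos: "N > 0"
proof -
  have "{0, 1} \<in> K" using n by simp
  then show ?thesis using finite_edges[of n] by (auto simp: N_def card_gt_0_iff)
qed

lemma q_nonneg: "q m \<ge> 0"
  using N_pos by (simp add: q_def)

lemma Z_nonneg: "Z m \<ge> 0"
  using s by (auto simp: Z_def wsum_def intro!: sum_nonneg)

lemma mean_mono: "(\<And>G. f G \<le> g G) \<Longrightarrow> mean m f \<le> mean m g"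
  unfolding mean_def using s Z_nonneg by (intro divide_right_mono wsum_mono) auto

lemma mean_sum: "mean m (\<lambda>G. \<Sum>i\<in>I. f i G) = (\<Sum>i\<in>I. mean m (f i))"
  by (simp add: mean_def wsum_sum sum_divide_distrib)

lemma mean_diff: "mean m (\<lambda>G. f G - g G) = mean m f - mean m g"
  by (simp add: mean_def wsum_diff diff_divide_distrib)

lemma mean_add: "mean m (\<lambda>G. f G + g G) = mean m f + mean m g"
  by (simp add: mean_def wsum_add add_divide_distrib)

lemma mean_cmult: "mean m (\<lambda>G. c * f G) = c * mean m f"
  by (simp add: mean_def wsum_cmult)

section \<open>The recursion in the number of edges\<close>

lemma rho_empty: "Z m > 0 \<Longrightarrow> \<rho> m {} = 1"
  by (simp add: \<rho>_def mean_def Z_def)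

text \<open>Summing over \<open>e\<close> the weight of the graphs that contain \<open>e\<close>
  counts each graph with \<open>Suc m\<close> edges \<open>Suc m\<close> times, and
  \<open>wsum_insert\<close> evaluates each summand.\<close>

lemma Z_Suc:
  assumes "Z m > 0"
  shows "Z (Suc m) = Z m * Q m / q (Suc m)"
proof -
  have "real (Suc m) * Z (Suc m) = (\<Sum>e\<in>K. wsum s n (Suc m) (\<lambda>G. of_bool (insert e {} \<subseteq> G)))"
    by (simp only: Z_def flip: sum_wsum_edges) simp
  also have "\<dots> = (\<Sum>e\<in>K. Z m * Y m {} e)"
  proof (intro sum.cong refl)
    fix e assume "e \<in> K"
    then show "wsum s n (Suc m) (\<lambda>G. of_bool (insert e {} \<subseteq> G)) = Z m * Y m {} e"
      using assms by (subst wsum_insert) (simp_all add: Y_def mean_def)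
  qed
  finally have "real (Suc m) * Z (Suc m) = Z m * (N * Q m)"
    using N_pos by (simp add: Q_def flip: sum_distrib_left)
  then show ?thesis
    using N_pos by (simp add: q_def field_simps del: of_nat_Suc)
qed

text \<open>The quotient of \<open>wsum_insert\<close> and \<open>Z_Suc\<close>. The unknown
  normalisation \<open>Z\<close> cancels; what remains compares \<open>Y m B e\<close> with the
  average \<open>Q m\<close> of the \<open>Y m {} e\<close>.\<close>

lemma rho_Suc:
  assumes "Z m > 0" "Q m > 0" "e \<in> K" "e \<notin> B"
  shows "\<rho> (Suc m) (insert e B) = q (Suc m) * Y m B e / Q m"
proof -
  have "wsum s n (Suc m) (\<lambda>G. of_bool (insert e B \<subseteq> G)) = Z m * Y m B e"
    using assms by (subst wsum_insert) (simp_all add: Y_def mean_def)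
  then show ?thesis
    using assms N_pos by (simp add: \<rho>_def mean_def Z_Suc q_def field_simps)
qed

lemma Y_le: "Y m B e \<le> \<rho> m B"
  unfolding Y_def \<rho>_def using s by (intro mean_mono) (auto intro: power_le_one)

text \<open>Only the vertices \<open>w\<close> outside \<open>B\<close> matter: a vertex of \<open>B\<close> can share an edge of \<open>B\<close> with
  its link, but there are few of those.\<close>

lemma Y_bounds:
  fixes m :: nat
  assumes e: "e \<in> K" and B: "finite B" "B \<subseteq> K"
  defines "U \<equiv> {..<n} - (e \<union> \<Union>B)"
  defines "D \<equiv> mean m (\<lambda>G. of_bool (B \<subseteq> G) * (\<Prod>w\<in>U. 1 - s * of_bool (link e w \<subseteq> G)))"
  shows "Y m B e \<le> D"
    and "D \<le> Y m B e + \<rho> m (insert e B) + (\<Sum>w\<in>\<Union>B - e. \<rho> m (B \<union> link e w))"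
proof -
  have sub: "\<Union>B \<subseteq> {..<n}" using B by (auto simp: nsets_def)
  have finUB: "finite (\<Union>B)" using sub by (rule finite_subset) simp
  let ?P = "\<lambda>A G. \<Prod>w\<in>A. 1 - s * of_bool (link e w \<subseteq> G) :: real"
  have P01: "0 \<le> ?P A G" "?P A G \<le> 1" for A G
    using s by (auto intro!: prod_in_unit_interval)
  have split: "(1 - s) ^ codeg n e G = ?P U G * ?P (\<Union>B - e) G" for G
  proof -
    have "{..<n} - e = U \<union> (\<Union>B - e)" using sub e by (auto simp: U_def)
    moreover have "U \<inter> (\<Union>B - e) = {}" by (auto simp: U_def)
    ultimately show ?thesis
      using finUB by (simp add: pow_codeg prod.union_disjoint U_def)
  qed
  have lower: "1 - (\<Sum>w\<in>\<Union>B - e. of_bool (link e w \<subseteq> G)) \<le> ?P (\<Union>B - e) G" for G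
  proof -
    have "1 - (\<Sum>w\<in>\<Union>B - e. s * of_bool (link e w \<subseteq> G)) \<le> ?P (\<Union>B - e) G"
      using s by (intro Weierstrass_prod_ineq) auto
    moreover have "(\<Sum>w\<in>\<Union>B - e. s * of_bool (link e w \<subseteq> G)) \<le> (\<Sum>w\<in>\<Union>B - e. of_bool (link e w \<subseteq> G))"
      using s by (intro sum_mono) auto
    ultimately show ?thesis by linarith
  qed
  have PP: "?P U G * ?P (\<Union>B - e) G \<le> ?P U G" for G
    by (intro mult_right_le_one_le P01)
  show "Y m B e \<le> D"
    unfolding Y_def D_def split
  proof (rule mean_mono)
    fix G
    show "of_bool (B \<subseteq> G \<and> e \<notin> G) * (?P U G * ?P (\<Union>B - e) G) \<le> of_bool (B \<subseteq> G) * ?P U G"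
      using PP[of G] P01(1)[where A = U and G = G] by (cases "B \<subseteq> G"; cases "e \<in> G") simp_all
  qed
  \<comment> \<open>\<open>Y\<close> falls short of \<open>D\<close> only through graphs that
    contain \<open>e\<close>, or through vertices of \<open>B\<close> whose link lies in the graph;
    the union bound gives one term for each.\<close>
  have "D \<le> mean m (\<lambda>G. (of_bool (B \<subseteq> G \<and> e \<notin> G) * (1 - s) ^ codeg n e G + of_bool (insert e B \<subseteq> G))
      + (\<Sum>w\<in>\<Union>B - e. of_bool (B \<union> link e w \<subseteq> G)))"
    unfolding D_def
  proof (rule mean_mono)
    fix G
    define p where "p = ?P U G"
    define p' where "p' = ?P (\<Union>B - e) G"
    define S where "S = (\<Sum>w\<in>\<Union>B - e. of_bool (link e w \<subseteq> G) :: real)"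
    have S0: "0 \<le> S" unfolding S_def by (intro sum_nonneg) auto
    have p01: "0 \<le> p" "p \<le> 1" unfolding p_def by (rule P01)+
    have p'01: "0 \<le> p'" "p' \<le> 1" unfolding p'_def by (rule P01)+
    have "1 - p' \<le> S" using lower[of G] unfolding p'_def S_def by linarith
    then have "p * (1 - p') \<le> 1 * S" using p01 p'01 by (intro mult_mono) simp_all
    then have *: "p \<le> p * p' + S" by (simp add: right_diff_distrib)
    have 0: "0 \<le> (\<Sum>w\<in>\<Union>B - e. of_bool (B \<union> link e w \<subseteq> G) :: real)" by (intro sum_nonneg) auto
    have "of_bool (B \<subseteq> G) * p \<le> of_bool (B \<subseteq> G \<and> e \<notin> G) * (p * p')
      + of_bool (insert e B \<subseteq> G) + (\<Sum>w\<in>\<Union>B - e. of_bool (B \<union> link e w \<subseteq> G))"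
    proof (cases "B \<subseteq> G")
      case True
      then have "(\<Sum>w\<in>\<Union>B - e. of_bool (B \<union> link e w \<subseteq> G)) = S"
        unfolding S_def by (intro sum.cong) auto
      then show ?thesis using True * p01 S0 by (cases "e \<in> G") simp_all
    qed (use 0 in simp)
    then show "of_bool (B \<subseteq> G) * ?P U G \<le> of_bool (B \<subseteq> G \<and> e \<notin> G) * (1 - s) ^ codeg n e G
      + of_bool (insert e B \<subseteq> G) + (\<Sum>w\<in>\<Union>B - e. of_bool (B \<union> link e w \<subseteq> G))"
      unfolding split p_def p'_def .
  qed
  also have "\<dots> = Y m B e + \<rho> m (insert e B) + (\<Sum>w\<in>\<Union>B - e. \<rho> m (B \<union> link e w))"
    by (simp only: mean_add mean_sum Y_def \<rho>_def)
  finally show "D \<le> Y m B e + \<rho> m (insert e B) + (\<Sum>w\<in>\<Union>B - e. \<rho> m (B \<union> link e w))" .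
qed

text \<open>Multiplying out the product selects the set \<open>J\<close> of vertices whose links are
  required, as in inclusion-exclusion. The right-hand side involves only correlations of graphs with
  \<open>m\<close> edges.\<close>

lemma mean_expand:
  assumes "finite U"
  shows "mean m (\<lambda>G. of_bool (B \<subseteq> G) * (\<Prod>w\<in>U. 1 - s * of_bool (link e w \<subseteq> G)))
      = (\<Sum>J\<in>Pow U. (- s) ^ card J * \<rho> m (B \<union> (\<Union>w\<in>J. link e w)))"
proof -
  have "of_bool (B \<subseteq> G) * (\<Prod>w\<in>U. 1 - s * of_bool (link e w \<subseteq> G))
      = (\<Sum>J\<in>Pow U. (- s) ^ card J * of_bool (B \<union> (\<Union>w\<in>J. link e w) \<subseteq> G))" for G
  proof -
    have "(\<Prod>w\<in>J. of_bool (link e w \<subseteq> G)) = (of_bool ((\<Union>w\<in>J. link e w) \<subseteq> G) :: real)" if "J \<in> Pow U" for J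
    proof -
      have "finite J" using that assms by (auto intro: finite_subset)
      then show ?thesis by (induction J) auto
    qed
    then show ?thesis
      unfolding prod_diff_conv_sum[OF assms] sum_distrib_left
      by (intro sum.cong refl) (simp add: prod.distrib power_mult_distrib[symmetric] flip: power_minus)
  qed
  then show ?thesis
    by (simp only: mean_sum mean_cmult \<rho>_def)
qed

lemma card_Union_edges:
  assumes "e \<in> K" "B \<subseteq> K"
  shows "card (\<Union>B) \<le> 2 * card B" "card (e \<union> \<Union>B) \<le> 2 + 2 * card B"
proof -
  have "card (\<Union>B) \<le> (\<Sum>b\<in>B. card b)" by (rule card_Union_le_sum_card)
  also have "\<dots> = (\<Sum>b\<in>B. 2)" using assms by (intro sum.cong) (auto simp: nsets_def)
  finally show 1: "card (\<Union>B) \<le> 2 * card B" by simp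
  show "card (e \<union> \<Union>B) \<le> 2 + 2 * card B"
    using card_Un_le[of e "\<Union>B"] 1 assms by (auto simp: nsets_def)
qed

text \<open>A first-order bound: the loss is at most the probability of \<open>e\<close> plus that
  of some link of \<open>e\<close>, a path of two edges for each \<open>w\<close>. It keeps
  \<open>Q m\<close> away from 0, so that the recursion may divide by it.\<close>

lemma Y_ge:
  assumes e: "e \<in> K" and Z: "Z m > 0" and a: "0 \<le> a" "a \<le> 1"
    and rho: "\<And>A. A \<subseteq> K \<Longrightarrow> \<rho> m A \<le> a ^ card A"
  shows "Y m {} e \<ge> 1 - (a + real n * a\<^sup>2)"
proof -
  let ?U = "{..<n} - e"
  have "1 - (\<Sum>w\<in>?U. \<rho> m (link e w)) = mean m (\<lambda>G. 1 - (\<Sum>w\<in>?U. of_bool (link e w \<subseteq> G)))"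
  proof -
    have "mean m (\<lambda>_. 1) = 1" using Z by (simp add: mean_def Z_def)
    then show ?thesis by (simp only: mean_diff mean_sum \<rho>_def)
  qed
  also have "\<dots> \<le> mean m (\<lambda>G. \<Prod>w\<in>?U. 1 - s * of_bool (link e w \<subseteq> G))"
  proof (rule mean_mono)
    fix G
    have "1 - (\<Sum>w\<in>?U. s * of_bool (link e w \<subseteq> G)) \<le> (\<Prod>w\<in>?U. 1 - s * of_bool (link e w \<subseteq> G))"
      using s by (intro Weierstrass_prod_ineq) auto
    moreover have "(\<Sum>w\<in>?U. s * of_bool (link e w \<subseteq> G)) \<le> (\<Sum>w\<in>?U. of_bool (link e w \<subseteq> G))"
      using s by (intro sum_mono) auto
    ultimately show "1 - (\<Sum>w\<in>?U. of_bool (link e w \<subseteq> G)) \<le> (\<Prod>w\<in>?U. 1 - s * of_bool (link e w \<subseteq> G))"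
      by linarith
  qed
  also have "\<dots> \<le> Y m {} e + \<rho> m {e}"
    using Y_bounds(2)[OF e, of "{}" m] by simp
  finally have 1: "1 - (\<Sum>w\<in>?U. \<rho> m (link e w)) \<le> Y m {} e + \<rho> m {e}" .
  have 2: "\<rho> m {e} \<le> a" using rho[of "{e}"] e by simp
  have "(\<Sum>w\<in>?U. \<rho> m (link e w)) \<le> (\<Sum>w\<in>?U. a\<^sup>2)"
  proof (rule sum_mono)
    fix w assume w: "w \<in> ?U"
    then show "\<rho> m (link e w) \<le> a\<^sup>2"
      using rho[of "link e w"] card_link[OF e, of w] link_edges[OF e, of w] by auto
  qed
  also have "\<dots> \<le> real n * a\<^sup>2"
    using card_mono[of "{..<n}" ?U] by (simp add: mult_right_mono del: card_Diff_insert)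
  finally show ?thesis using 1 2 by linarith
qed

text \<open>The contraction estimate. Replacing each correlation in \<open>mean_expand\<close> by
  its independent value gives the main term, and the replacement errors add up to the term with
  \<open>\<epsilon>\<close>. The last term pays for passing from \<open>Y\<close> to
  \<open>D\<close> and for the exponent \<open>n\<close> in place of \<open>card U\<close>.\<close>

lemma Y_approx:
  assumes e: "e \<in> K" "e \<notin> B" and B: "B \<subseteq> K" and tf: "triangle_free (insert e B)"
    and a: "q m \<le> a" "a \<le> 1" and r: "0 \<le> r" and \<epsilon>: "0 \<le> \<epsilon>"
    and apriori: "\<And>A. A \<subseteq> K \<Longrightarrow> \<rho> m A \<le> a ^ card A"
    and approx: "\<And>A. A \<subseteq> K \<Longrightarrow> triangle_free A \<Longrightarrow> \<bar>\<rho> m A - q m ^ card A\<bar> \<le> \<epsilon> * r ^ card A"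
  shows "\<bar>Y m B e - (1 - s * (q m)\<^sup>2) ^ n * q m ^ card B\<bar>
     \<le> \<epsilon> * r ^ card B * exp (real n * r\<^sup>2) + (3 + 4 * real (card B)) * a ^ Suc (card B)"
proof -
  define b where "b = card B"
  define U where "U = {..<n} - (e \<union> \<Union>B)"
  define D where "D = mean m (\<lambda>G. of_bool (B \<subseteq> G) * (\<Prod>w\<in>U. 1 - s * of_bool (link e w \<subseteq> G)))"
  define y where "y = s * (q m)\<^sup>2"
  have q0: "0 \<le> q m" by (rule q_nonneg)
  have a0: "0 \<le> a" using q0 a by linarith
  have finB: "finite B" using B finite_edges by (rule finite_subset)
  have finU: "finite U" by (simp add: U_def)
  have subn: "e \<union> \<Union>B \<subseteq> {..<n}" using e B by (auto simp: nsets_def)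
  have finUB: "finite (\<Union>B)" using subn by (auto intro: finite_subset)
  have y01: "0 \<le> y" "y \<le> 1" "y \<le> (q m)\<^sup>2"
  proof -
    have "(q m)\<^sup>2 \<le> 1" using q0 a by (auto intro: power_le_one)
    then show "y \<le> 1" unfolding y_def using s by (intro mult_le_one) auto
    show "y \<le> (q m)\<^sup>2" unfolding y_def using s by (intro mult_left_le_one_le) auto
    show "0 \<le> y" using s by (simp add: y_def)
  qed
  have 1: "\<bar>Y m B e - D\<bar> \<le> (1 + 2 * real b) * a ^ Suc b"
  proof -
    have "\<rho> m (insert e B) \<le> a ^ Suc b"
      using apriori[of "insert e B"] e B finB by (simp add: b_def)
    moreover have "(\<Sum>w\<in>\<Union>B - e. \<rho> m (B \<union> link e w)) \<le> (\<Sum>w\<in>\<Union>B - e. a ^ Suc b)"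
    proof (rule sum_mono)
      fix w assume w: "w \<in> \<Union>B - e"
      then have lk: "link e w \<subseteq> K" using subn e by (intro link_edges) auto
      have "B \<subset> B \<union> link e w" using triangle_free_link[OF tf e(1)] w by auto
      then have "card B < card (B \<union> link e w)"
        using finB lk finite_edges by (intro psubset_card_mono) (auto intro: finite_subset)
      then have "a ^ card (B \<union> link e w) \<le> a ^ Suc b"
        using a a0 by (intro power_decreasing) (auto simp: b_def)
      then show "\<rho> m (B \<union> link e w) \<le> a ^ Suc b"
        using apriori[of "B \<union> link e w"] B lk by auto
    qed
    moreover have "(\<Sum>w\<in>\<Union>B - e. a ^ Suc b) \<le> 2 * real b * a ^ Suc b"
    proof -
      have "card (\<Union>B - e) \<le> card (\<Union>B)" using finUB by (intro card_mono) auto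
      then have "card (\<Union>B - e) \<le> 2 * b" using card_Union_edges(1)[OF e(1) B] by (simp add: b_def)
      then have "real (card (\<Union>B - e)) \<le> 2 * real b" by linarith
      then show ?thesis using a0 by (simp only: sum_constant) (intro mult_right_mono, auto)
    qed
    ultimately show ?thesis
      using Y_bounds[OF e(1) finB B, of m] unfolding D_def U_def by (simp add: distrib_right)
  qed
  have 2: "\<bar>D - q m ^ b * (1 - y) ^ card U\<bar> \<le> \<epsilon> * r ^ b * exp (real n * r\<^sup>2)"
  proof -
    let ?A = "\<lambda>J. B \<union> (\<Union>w\<in>J. link e w)"
    have A: "?A J \<subseteq> K" "triangle_free (?A J)" "card (?A J) = b + 2 * card J" if "J \<in> Pow U" for J
    proof -
      have J: "J \<subseteq> U" "finite J" "J \<inter> (e \<union> \<Union>B) = {}"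
        using that finU by (auto simp: U_def intro: finite_subset)
      have "link e w \<subseteq> K" if "w \<in> J" for w
        using that J by (intro link_edges[OF e(1)]) (auto simp: U_def)
      then show "?A J \<subseteq> K" using B by blast
      have "triangle_free B" using tf by (auto simp: triangle_free_def)
      then show "triangle_free (?A J)" using J e by (intro triangle_free_Un_links)
      show "card (?A J) = b + 2 * card J" using J finB e by (simp add: card_Un_links b_def)
    qed
    \<comment> \<open>The main term has the same expansion with independent correlations, so the two
      sums can be compared term by term.\<close>
    have "q m ^ b * (1 - y) ^ card U = (\<Sum>J\<in>Pow U. (- s) ^ card J * q m ^ card (?A J))"
    proof -
      have "q m ^ b * (1 - y) ^ card U = q m ^ b * (\<Sum>J\<in>Pow U. (- y) ^ card J)"
        using sum_Pow_power_card[OF finU, of "- y"] by simp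
      also have "\<dots> = (\<Sum>J\<in>Pow U. (- s) ^ card J * q m ^ card (?A J))"
        unfolding sum_distrib_left y_def
        by (intro sum.cong refl) (simp add: A power_add power_mult flip: power_mult_distrib)
      finally show ?thesis .
    qed
    then have "\<bar>D - q m ^ b * (1 - y) ^ card U\<bar>
        = \<bar>\<Sum>J\<in>Pow U. (- s) ^ card J * (\<rho> m (?A J) - q m ^ card (?A J))\<bar>"
      unfolding D_def mean_expand[OF finU] by (simp add: sum_subtractf right_diff_distrib)
    \<comment> \<open>Giving up the cancellation in this alternating sum costs only the factor
      \<open>exp (real n * r\<^sup>2)\<close>, which stays bounded when \<open>r\<close> is of order
      \<open>n powr (-1/2)\<close>.\<close>
    also have "\<dots> \<le> (\<Sum>J\<in>Pow U. \<bar>(- s) ^ card J * (\<rho> m (?A J) - q m ^ card (?A J))\<bar>)"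
      by (rule sum_abs)
    also have "\<dots> \<le> (\<Sum>J\<in>Pow U. \<epsilon> * r ^ b * (r\<^sup>2) ^ card J)"
    proof (rule sum_mono)
      fix J assume J: "J \<in> Pow U"
      have "\<bar>(- s) ^ card J * (\<rho> m (?A J) - q m ^ card (?A J))\<bar>
          \<le> 1 * (\<epsilon> * r ^ card (?A J))"
        unfolding abs_mult using s approx[OF A(1,2)[OF J]]
        by (intro mult_mono) (auto simp: power_abs intro: power_le_one)
      then show "\<bar>(- s) ^ card J * (\<rho> m (?A J) - q m ^ card (?A J))\<bar> \<le> \<epsilon> * r ^ b * (r\<^sup>2) ^ card J"
        by (simp only: A(3)[OF J] power_add power_mult mult_1_left mult.assoc)
    qed
    also have "\<dots> = \<epsilon> * r ^ b * (1 + r\<^sup>2) ^ card U"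
      by (simp add: sum_Pow_power_card[OF finU] flip: sum_distrib_left)
    also have "\<dots> \<le> \<epsilon> * r ^ b * exp (real n * r\<^sup>2)"
    proof (rule mult_left_mono)
      have "(1 + r\<^sup>2) ^ card U \<le> (1 + r\<^sup>2) ^ n"
        using card_mono[of "{..<n}" U] by (intro power_increasing) (auto simp: U_def)
      also have "\<dots> \<le> exp (r\<^sup>2) ^ n"
        by (intro power_mono) auto
      also have "\<dots> = exp (real n * r\<^sup>2)" by (simp add: exp_of_nat_mult)
      finally show "(1 + r\<^sup>2) ^ card U \<le> exp (real n * r\<^sup>2)" .
    qed (use \<epsilon> r in simp)
    finally show ?thesis .
  qed
  \<comment> \<open>The exponents differ by at most \<open>2 + 2 * b\<close>, and by Bernoulli's
    inequality each missing factor costs at most \<open>y \<le> (q m)\<^sup>2\<close>.\<close>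
  have 3: "\<bar>q m ^ b * (1 - y) ^ card U - (1 - y) ^ n * q m ^ b\<bar> \<le> (2 + 2 * real b) * a ^ Suc b"
  proof -
    have cU: "card U = n - card (e \<union> \<Union>B)"
      using card_Diff_subset[OF finite_subset[OF subn] subn] by (simp add: U_def)
    have cle: "card (e \<union> \<Union>B) \<le> n" using card_mono[OF _ subn] by simp
    define k where "k = card (e \<union> \<Union>B)"
    have nk: "n = card U + k" using cU cle by (simp add: k_def)
    have k: "real k \<le> 2 + 2 * real b"
      using card_Union_edges(2)[OF e(1) B] unfolding k_def b_def by linarith
    have "1 + real k * (- y) \<le> (1 + (- y)) ^ k"
      by (rule Bernoulli_inequality) (use y01 in auto)
    then have "1 - (1 - y) ^ k \<le> real k * y" by simp
    then have "(1 - y) ^ card U * (1 - (1 - y) ^ k) \<le> 1 * (real k * y)"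
      using y01 by (intro mult_mono power_le_one) (auto intro: power_le_one)
    moreover have "0 \<le> (1 - y) ^ card U * (1 - (1 - y) ^ k)"
      using y01 by (intro mult_nonneg_nonneg) (auto intro: power_le_one)
    ultimately have "\<bar>(1 - y) ^ card U - (1 - y) ^ n\<bar> \<le> real k * y"
      unfolding nk by (simp add: power_add right_diff_distrib)
    also have "\<dots> \<le> (2 + 2 * real b) * (q m)\<^sup>2"
      using k y01 by (intro mult_mono) auto
    finally have "q m ^ b * \<bar>(1 - y) ^ card U - (1 - y) ^ n\<bar> \<le> q m ^ b * ((2 + 2 * real b) * (q m)\<^sup>2)"
      using q0 by (intro mult_left_mono) auto
    also have "\<dots> = (2 + 2 * real b) * q m ^ (b + 2)" by (simp add: power_add power2_eq_square)
    also have "\<dots> \<le> (2 + 2 * real b) * a ^ Suc b"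
    proof -
      have "q m ^ (b + 2) \<le> a ^ (b + 2)" using q0 a by (intro power_mono) auto
      also have "\<dots> \<le> a ^ Suc b" using a a0 by (intro power_decreasing) auto
      finally show ?thesis by (intro mult_left_mono) auto
    qed
    finally have "\<bar>q m ^ b * ((1 - y) ^ card U - (1 - y) ^ n)\<bar> \<le> (2 + 2 * real b) * a ^ Suc b"
      using q0 by (simp add: abs_mult)
    then show ?thesis by (simp add: right_diff_distrib mult.commute)
  qed
  have "(3 + 4 * real b) * a ^ Suc b = (1 + 2 * real b) * a ^ Suc b + (2 + 2 * real b) * a ^ Suc b"
    by (simp add: algebra_simps)
  then show ?thesis
    using 1 2 3 unfolding b_def[symmetric] y_def[symmetric] by linarith
qed

end

section \<open>Induction on the number of edges\<close>

context tilted_graphs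
begin

lemma Q_average:
  assumes "\<And>e. e \<in> K \<Longrightarrow> \<bar>Y m {} e - c\<bar> \<le> d"
  shows "\<bar>Q m - c\<bar> \<le> d"
proof -
  have "N * (Q m - c) = (\<Sum>e\<in>K. Y m {} e - c)"
    using N_pos by (simp add: Q_def sum_subtractf right_diff_distrib) (simp add: N_def)
  also have "\<bar>\<dots>\<bar> \<le> (\<Sum>e\<in>K. \<bar>Y m {} e - c\<bar>)" by (rule sum_abs)
  also have "\<dots> \<le> (\<Sum>e\<in>K. d)" using assms by (intro sum_mono)
  also have "\<dots> = N * d" by (simp add: N_def)
  finally show ?thesis using N_pos by (simp add: abs_mult)
qed

lemma Q_ge:
  assumes "\<And>e. e \<in> K \<Longrightarrow> c \<le> Y m {} e"
  shows "c \<le> Q m"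
proof -
  have "N * c = (\<Sum>e\<in>K. c)" by (simp add: N_def)
  also have "\<dots> \<le> (\<Sum>e\<in>K. Y m {} e)" using assms by (intro sum_mono)
  also have "\<dots> = N * Q m" using N_pos by (simp add: Q_def)
  finally show ?thesis using N_pos by simp
qed

lemma graphs_0: "graphs n 0 = {{}}"
proof -
  have "finite E" if "E \<subseteq> K" for E using that finite_edges by (rule finite_subset)
  then show ?thesis by (auto simp: graphs_def)
qed

lemma triangles_empty: "triangles n {} = 0"
proof -
  have "nsets T 2 \<noteq> {}" if "T \<in> nsets {..<n} 3" for T
    using that unfolding nsets_eq_empty_iff by (simp add: nsets_def)
  then have "{T \<in> nsets {..<n} 3. nsets T 2 \<subseteq> {}} = {}" by blast
  then show ?thesis by (simp only: triangles_def card.empty)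
qed

lemma Z_0: "Z 0 = 1" and rho_0: "\<rho> 0 A = of_bool (A = {})"
  by (simp_all add: Z_def \<rho>_def mean_def wsum_def graphs_0 triangles_empty)

lemma q_mono: "m \<le> m' \<Longrightarrow> q m \<le> q m'"
  using N_pos by (simp add: q_def divide_right_mono)

end

text \<open>\<open>M\<close> is the final number of edges. The factor 2 in \<open>a\<close> absorbs
  the division by \<open>Q m \<ge> 1/2\<close>, a bound that \<open>a1\<close> provides through
  \<open>Y_ge\<close>. \<open>exp_a\<close> controls the error factor of \<open>Y_approx\<close> for
  \<open>r = 4 * a\<close>, and \<open>Na\<close> says that one more edge raises the density by at
  most \<open>a\<^sup>2\<close>.\<close>

locale sparse_tilted_graphs = tilted_graphs +
  fixes M :: nat and a :: real
  assumes a_def: "a = 2 * q M" and a1: "a + real n * a\<^sup>2 \<le> 1/2" and Na: "1 \<le> N * a\<^sup>2"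
    and exp_a: "exp (16 * real n * a\<^sup>2) \<le> 3/2"
begin

lemma a_pos: "0 < a"
  using q_nonneg[of M] Na by (cases "a = 0") (auto simp: a_def)

lemma a_le: "a \<le> 1/2"
  using a1 by (smt (verit) mult_nonneg_nonneg of_nat_0_le_iff zero_le_power2)

lemma q_le: "m \<le> M \<Longrightarrow> q m \<le> a / 2"
  using q_mono[of m M] by (simp add: a_def)

text \<open>This is \<open>Y_approx\<close> with \<open>\<epsilon> = 9 * a\<close> and
  \<open>r = 4 * a\<close>. The constant is 35/2 = 9 * 3/2 + 4, where 3/2 comes from
  \<open>exp_a\<close> and 4 from \<open>3 + 4 * l \<le> 4 * 4 ^ l\<close>.\<close>

lemma Y_near:
  assumes e: "e \<in> K" "e \<notin> B" and B: "B \<subseteq> K" and tf: "triangle_free (insert e B)" and m: "m \<le> M"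
    and apriori: "\<And>A. A \<subseteq> K \<Longrightarrow> \<rho> m A \<le> a ^ card A"
    and approx: "\<And>A. A \<subseteq> K \<Longrightarrow> triangle_free A \<Longrightarrow> \<bar>\<rho> m A - q m ^ card A\<bar> \<le> 9 * a * (4 * a) ^ card A"
  shows "\<bar>Y m B e - (1 - s * (q m)\<^sup>2) ^ n * q m ^ card B\<bar> \<le> 35/2 * a * (4 * a) ^ card B"
proof -
  define l where "l = card B"
  have "\<bar>Y m B e - (1 - s * (q m)\<^sup>2) ^ n * q m ^ l\<bar>
      \<le> 9 * a * (4 * a) ^ l * exp (real n * (4 * a)\<^sup>2) + (3 + 4 * real l) * a ^ Suc l"
    unfolding l_def
  proof (rule Y_approx[OF e B tf _ _ _ _ apriori approx])
    show "q m \<le> a" "a \<le> 1" "0 \<le> 4 * a" "0 \<le> 9 * a" using q_le[OF m] a_pos a_le by linarith+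
  qed
  also have "\<dots> \<le> 9 * a * (4 * a) ^ l * (3/2) + 4 * a * (4 * a) ^ l"
  proof (rule add_mono)
    have "exp (real n * (4 * a)\<^sup>2) \<le> 3/2"
      using exp_a by (simp add: power_mult_distrib mult_ac)
    then show "9 * a * (4 * a) ^ l * exp (real n * (4 * a)\<^sup>2) \<le> 9 * a * (4 * a) ^ l * (3/2)"
      using a_pos by (intro mult_left_mono) auto
    have "3 + 4 * real l \<le> 4 * 4 ^ l"
      by (induction l) auto
    then have "(3 + 4 * real l) * a ^ Suc l \<le> 4 * 4 ^ l * a ^ Suc l"
      using a_pos by (intro mult_right_mono) auto
    then show "(3 + 4 * real l) * a ^ Suc l \<le> 4 * a * (4 * a) ^ l"
      by (simp add: power_mult_distrib mult_ac)
  qed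
  also have "\<dots> = 35/2 * a * (4 * a) ^ l" by (simp add: algebra_simps)
  finally show ?thesis unfolding l_def .
qed

lemma power_q_Suc:
  assumes "Suc m \<le> M"
  shows "\<bar>q m ^ l - q (Suc m) ^ l\<bar> \<le> a * (4 * a) ^ l"
proof -
  \<comment> \<open>Both densities are at most \<open>c\<close>, so after division by
    \<open>c\<close> the Lipschitz bound for powers on the unit interval applies;
    \<open>8 * c = 4 * a\<close> restores the base.\<close>
  define c where "c = a / 2"
  have c: "c > 0" using a_pos by (simp add: c_def)
  have le: "q m \<le> c" "q (Suc m) \<le> c" using q_le assms by (auto simp: c_def)
  have "norm ((q m / c) ^ l - (q (Suc m) / c) ^ l) \<le> real l * norm (q m / c - q (Suc m) / c)"
    using le q_nonneg c by (intro norm_power_diff) auto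
  also have "norm (q m / c - q (Suc m) / c) = 1 / (N * c)"
    using N_pos c by (simp add: q_def field_simps)
  also have "1 / (N * c) \<le> 2 * a"
    using Na N_pos c by (simp add: c_def field_simps power2_eq_square)
  also have "real l * (2 * a) \<le> a * 8 ^ l"
  proof -
    have "2 * real l < 8 ^ l"
    proof (induction l)
      case (Suc l)
      define x where "x = (8 :: real) ^ l"
      have "1 \<le> x" "2 * real l < x" using Suc by (simp_all add: x_def)
      then show ?case by (simp flip: x_def)
    qed simp
    then show ?thesis using a_pos mult_left_mono[of "2 * real l" "8 ^ l" a] by (simp add: mult_ac)
  qed
  finally have *: "\<bar>(q m / c) ^ l - (q (Suc m) / c) ^ l\<bar> \<le> a * 8 ^ l" by (simp add: mult_left_mono)
  have "q m ^ l - q (Suc m) ^ l = c ^ l * ((q m / c) ^ l - (q (Suc m) / c) ^ l)"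
    using c by (simp add: power_divide right_diff_distrib)
  then have "\<bar>q m ^ l - q (Suc m) ^ l\<bar> \<le> c ^ l * (a * 8 ^ l)"
    using * c by (simp add: abs_mult mult_left_mono)
  also have "\<dots> = a * (c * 8) ^ l" by (simp add: power_mult_distrib)
  finally show ?thesis by (simp add: c_def)
qed

text \<open>Both bounds go through the induction together: the error terms of
  \<open>Y_approx\<close> involve sets that may contain triangles, for which only the first bound is
  available. For the second, the recursion multiplies by at most \<open>a\<close> while one more
  edge allows \<open>4 * a\<close>; this gain of 4 is the contraction.\<close>

lemma correlations:
  assumes "m \<le> M"
  shows "Z m > 0 \<and> (\<forall>A\<subseteq>K. \<rho> m A \<le> a ^ card A) \<and>
    (\<forall>A\<subseteq>K. triangle_free A \<longrightarrow> \<bar>\<rho> m A - q m ^ card A\<bar> \<le> 9 * a * (4 * a) ^ card A)"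
  using assms
proof (induction m)
  case 0
  \<comment> \<open>Here \<open>q 0 = 0\<close>, and \<open>0 ^ 0 = 1\<close> covers the empty set,
    so the approximation is exact.\<close>
  have eq: "\<rho> 0 A = q 0 ^ card A" if "A \<subseteq> K" for A
  proof -
    have "finite A" using that finite_edges by (rule finite_subset)
    then show ?thesis by (simp add: rho_0 q_def power_0_left)
  qed
  have "q 0 ^ k \<le> a ^ k" for k using a_pos by (intro power_mono) (simp_all add: q_def)
  moreover have "0 \<le> 9 * a * (4 * a) ^ k" for k using a_pos by simp
  ultimately show ?case
    by (intro conjI allI impI) (simp_all only: Z_0 eq diff_self abs_zero zero_less_one)
next
  case (Suc m)
  define q' where "q' = q (Suc m)"
  define P where "P = (1 - s * (q m)\<^sup>2) ^ n"
  have m: "m \<le> M" using Suc by simp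
  have Zm: "Z m > 0" and apriori: "\<And>A. A \<subseteq> K \<Longrightarrow> \<rho> m A \<le> a ^ card A"
    and approx: "\<And>A. A \<subseteq> K \<Longrightarrow> triangle_free A \<Longrightarrow> \<bar>\<rho> m A - q m ^ card A\<bar> \<le> 9 * a * (4 * a) ^ card A"
    using Suc m by auto
  have "1/2 \<le> Y m {} e" if "e \<in> K" for e
    using Y_ge[OF that Zm, of a] apriori a1 a_pos a_le by force
  then have Q: "1/2 \<le> Q m" by (rule Q_ge)
  have q'0: "0 < q'" using N_pos by (simp add: q'_def q_def)
  have q'a: "q' \<le> a / 2" using q_le[OF Suc.prems] by (simp add: q'_def)
  have qQ: "0 \<le> q' / Q m" "q' / Q m \<le> a"
  proof -
    show "0 \<le> q' / Q m" using q'0 Q by simp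
    have "q' \<le> a * (1/2)" using q'a by simp
    also have "\<dots> \<le> a * Q m" using Q a_pos by (intro mult_left_mono) auto
    finally show "q' / Q m \<le> a" using Q by (simp add: divide_le_eq)
  qed
  have Z': "Z (Suc m) > 0" using Zm Q q'0 by (simp add: Z_Suc q'_def)
  have A_cases: "A = {} \<or> (\<exists>e B. A = insert e B \<and> e \<notin> B \<and> e \<in> K \<and> B \<subseteq> K \<and> card A = Suc (card B))" if A: "A \<subseteq> K" for A
  proof (cases "A = {}")
    case False
    then obtain e where e: "e \<in> A" by blast
    have "finite A" using A finite_edges by (rule finite_subset)
    then have "card A = Suc (card (A - {e}))" using e by (rule card.remove)
    moreover have "A = insert e (A - {e})" "e \<in> K" "A - {e} \<subseteq> K" using e A by auto
    ultimately have "A = insert e (A - {e}) \<and> e \<notin> A - {e} \<and> e \<in> K \<and> A - {e} \<subseteq> K \<and> card A = Suc (card (A - {e}))"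
      by simp
    then show ?thesis by (intro disjI2 exI)
  qed simp
  have rho': "\<rho> (Suc m) (insert e B) = q' / Q m * Y m B e" if "e \<in> K" "e \<notin> B" for e B
    using rho_Suc[OF Zm _ that] Q by (simp add: q'_def)
  have 1: "\<rho> (Suc m) A \<le> a ^ card A" if A: "A \<subseteq> K" for A
    using A_cases[OF A]
  proof
    assume "A = {}" then show ?thesis using rho_empty[OF Z'] by simp
  next
    assume "\<exists>e B. A = insert e B \<and> e \<notin> B \<and> e \<in> K \<and> B \<subseteq> K \<and> card A = Suc (card B)"
    then obtain e B where eB: "A = insert e B" "e \<notin> B" "e \<in> K" "B \<subseteq> K" "card A = Suc (card B)" by blast
    have "q' / Q m * Y m B e \<le> q' / Q m * a ^ card B"
      using Y_le[of m B e] apriori[OF eB(4)] qQ by (intro mult_left_mono) auto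
    also have "\<dots> \<le> a * a ^ card B" using qQ a_pos by (intro mult_right_mono) auto
    finally show ?thesis using rho'[OF eB(3,2)] eB by simp
  qed
  have 2: "\<bar>\<rho> (Suc m) A - q' ^ card A\<bar> \<le> 9 * a * (4 * a) ^ card A" if A: "A \<subseteq> K" "triangle_free A" for A
    using A_cases[OF A(1)]
  proof
    assume "A = {}" then show ?thesis using rho_empty[OF Z'] a_pos by simp
  next
    assume "\<exists>e B. A = insert e B \<and> e \<notin> B \<and> e \<in> K \<and> B \<subseteq> K \<and> card A = Suc (card B)"
    then obtain e B where eB: "A = insert e B" "e \<notin> B" "e \<in> K" "B \<subseteq> K" "card A = Suc (card B)" by blast
    define l where "l = card B"
    have near: "\<bar>Y m B e - P * q m ^ l\<bar> \<le> 35/2 * a * (4 * a) ^ l"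
      unfolding P_def l_def using A eB m by (intro Y_near apriori approx) auto
    \<comment> \<open>The case of empty \<open>B\<close>, averaged over all edges, controls the
      denominator \<open>Q m\<close>.\<close>
    have "\<bar>Y m {} f - P\<bar> \<le> 35/2 * a" if "f \<in> K" for f
    proof -
      have "triangle_free {f}" by (auto simp: triangle_free_def doubleton_eq_iff)
      then have "\<bar>Y m {} f - P * q m ^ card ({} :: nat set set)\<bar> \<le> 35/2 * a * (4 * a) ^ card ({} :: nat set set)"
        unfolding P_def using that m by (intro Y_near apriori approx) auto
      then show ?thesis by simp
    qed
    then have QP: "\<bar>Q m - P\<bar> \<le> 35/2 * a" by (rule Q_average)
    have P01: "0 \<le> P" "P \<le> 1"
    proof -
      have "(q m)\<^sup>2 \<le> 1" using q_nonneg q_le[OF m] a_le by (auto intro!: power_le_one)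
      then have "s * (q m)\<^sup>2 \<le> 1" using s by (intro mult_le_one) auto
      then show "0 \<le> P" "P \<le> 1" using s by (auto simp: P_def intro!: power_le_one)
    qed
    have t2: "\<bar>P * q m ^ l - P * q' ^ l\<bar> \<le> a * (4 * a) ^ l"
    proof -
      have "\<bar>P * q m ^ l - P * q' ^ l\<bar> = P * \<bar>q m ^ l - q' ^ l\<bar>"
        using P01 by (simp add: abs_mult flip: right_diff_distrib)
      also have "\<dots> \<le> \<bar>q m ^ l - q' ^ l\<bar>" using P01 by (intro mult_left_le_one_le) auto
      also have "\<dots> \<le> a * (4 * a) ^ l" using power_q_Suc[OF Suc.prems] by (simp add: q'_def)
      finally show ?thesis .
    qed
    have t3: "\<bar>P * q' ^ l - Q m * q' ^ l\<bar> \<le> 35/2 * a * (4 * a) ^ l"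
    proof -
      have "\<bar>P * q' ^ l - Q m * q' ^ l\<bar> = \<bar>Q m - P\<bar> * q' ^ l"
        using q'0 by (simp add: abs_mult abs_minus_commute flip: left_diff_distrib)
      also have "\<dots> \<le> 35/2 * a * (4 * a) ^ l"
        using QP q'0 q'a a_pos by (intro mult_mono power_mono) auto
      finally show ?thesis .
    qed
    \<comment> \<open>The errors add up to 35/2 + 1 + 35/2 = 36. Multiplied by
      \<open>q' / Q m \<le> a\<close> this is \<open>9 * (4 * a)\<close>, which reproduces the
      constant 9 with one more edge.\<close>
    have "\<bar>Y m B e - Q m * q' ^ l\<bar> \<le> 36 * a * (4 * a) ^ l"
      using near t2 t3 unfolding mult.assoc by linarith
    then have "q' / Q m * \<bar>Y m B e - Q m * q' ^ l\<bar> \<le> a * (36 * a * (4 * a) ^ l)"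
      using qQ a_pos by (intro mult_mono) auto
    moreover have "\<rho> (Suc m) A - q' ^ card A = q' / Q m * (Y m B e - Q m * q' ^ l)"
      using rho'[OF eB(3,2)] eB Q by (simp add: l_def right_diff_distrib)
    moreover have "a * (36 * a * (4 * a) ^ l) = 9 * a * (4 * a) ^ card A"
      using eB by (simp add: l_def)
    ultimately show ?thesis using qQ(1) by (simp only: abs_mult abs_of_nonneg)
  qed
  show ?case using Z' 1 2 by (simp add: q'_def)
qed

lemma Z_pos: "m \<le> M \<Longrightarrow> Z m > 0"
  using correlations by blast

lemma Q_bounds:
  assumes m: "m \<le> M"
  shows "1/2 \<le> Q m" "\<bar>Q m - (1 - s * (q m)\<^sup>2) ^ n\<bar> \<le> 35/2 * a"
proof -
  have Zm: "Z m > 0" and apriori: "\<And>A. A \<subseteq> K \<Longrightarrow> \<rho> m A \<le> a ^ card A"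
    and approx: "\<And>A. A \<subseteq> K \<Longrightarrow> triangle_free A \<Longrightarrow> \<bar>\<rho> m A - q m ^ card A\<bar> \<le> 9 * a * (4 * a) ^ card A"
    using correlations[OF m] by auto
  have "1/2 \<le> Y m {} e" if "e \<in> K" for e
    using Y_ge[OF that Zm, of a] apriori a1 a_pos a_le by force
  then show "1/2 \<le> Q m" by (rule Q_ge)
  have "\<bar>Y m {} f - (1 - s * (q m)\<^sup>2) ^ n\<bar> \<le> 35/2 * a" if "f \<in> K" for f
  proof -
    have "triangle_free {f}" by (auto simp: triangle_free_def doubleton_eq_iff)
    then have "\<bar>Y m {} f - (1 - s * (q m)\<^sup>2) ^ n * q m ^ card ({} :: nat set set)\<bar>
        \<le> 35/2 * a * (4 * a) ^ card ({} :: nat set set)"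
      using that m by (intro Y_near apriori approx) auto
    then show ?thesis by simp
  qed
  then show "\<bar>Q m - (1 - s * (q m)\<^sup>2) ^ n\<bar> \<le> 35/2 * a" by (rule Q_average)
qed

end

section \<open>The moment generating function\<close>

lemma card_graphs: "card (graphs n m) = (card (nsets {..<n} 2) choose m)"
  unfolding graphs_def by (rule n_subsets) (rule finite_edges)

lemma Suc_binomial: "Suc k * (n choose Suc k) = (n - k) * (n choose k)"
  by (simp only: binomial_absorption binomial_absorb_comp)

text \<open>For \<open>s = 1\<close> this is the probability that there are no triangles, as \<open>0 ^ 0 = 1\<close>.\<close>

definition mgf :: "real \<Rightarrow> nat \<Rightarrow> nat \<Rightarrow> real" where
  "mgf s n m = measure_pmf.expectation (Gnm n m) (\<lambda>G. (1 - s) ^ triangles n G)"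

lemma expectation_Gnm:
  assumes "m \<le> card (nsets {..<n} 2)"
  shows "measure_pmf.expectation (Gnm n m) f = (\<Sum>G\<in>graphs n m. f G) / card (graphs n m)"
proof -
  have "card (graphs n m) \<noteq> 0" using assms by (simp add: card_graphs)
  then show ?thesis
    unfolding Gnm_def by (intro integral_pmf_of_set) (auto simp: finite_graphs)
qed

context sparse_tilted_graphs
begin

lemma M_le: "real M \<le> N / 2" "M \<le> card K"
proof -
  have "q M \<le> 1/4" using a_le by (simp add: a_def)
  then show "real M \<le> N / 2" using N_pos by (simp add: q_def field_simps)
  then show "M \<le> card K" using N_pos unfolding N_def by linarith
qed

lemma mgf_eq:
  assumes "m \<le> M"
  shows "mgf s n m = Z m / (card K choose m)"
  unfolding mgf_def Z_def wsum_def using assms M_le(2)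
  by (subst expectation_Gnm) (simp_all add: card_graphs)

lemma mgf_pos: "m \<le> M \<Longrightarrow> mgf s n m > 0"
  using Z_pos[of m] M_le(2) by (simp add: mgf_eq)

text \<open>Dividing \<open>Z_Suc\<close> by the corresponding step of the binomial coefficient
  cancels \<open>Suc m\<close>.\<close>

lemma mgf_Suc:
  assumes "Suc m \<le> M"
  shows "mgf s n (Suc m) = mgf s n m * (Q m * (N / (N - real m)))"
proof -
  have mK: "m < card K" using assms M_le(2) by simp
  have "real (Suc m) * real (card K choose Suc m) = (N - real m) * real (card K choose m)"
    using Suc_binomial[of m "card K"] mK unfolding N_def
    by (metis of_nat_diff of_nat_mult less_imp_le)
  moreover have "Z (Suc m) * real (Suc m) = Z m * (N * Q m)"
    using Z_Suc[OF Z_pos[of m]] assms N_pos by (simp add: q_def del: of_nat_Suc)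
  moreover have "N - real m > 0" using mK by (simp add: N_def)
  moreover have "real (card K choose m) > 0" "real (card K choose Suc m) > 0" using mK by simp_all
  ultimately have "Z (Suc m) * ((N - real m) * real (card K choose m)) = Z m * (N * Q m) * real (card K choose Suc m)"
    by (metis mult.assoc mult.commute)
  then show ?thesis
    using assms \<open>N - real m > 0\<close> \<open>real (card K choose m) > 0\<close> \<open>real (card K choose Suc m) > 0\<close>
    by (simp add: mgf_eq field_simps)
qed

text \<open>Three errors: \<open>ln (Q m)\<close> is within \<open>35 * a\<close> of
  \<open>ln P\<close> because both arguments are at least 1/2; the quadratic remainder of
  \<open>ln (1 - y)\<close>, taken \<open>n\<close> times, is at most \<open>2 * n * a ^ 4\<close>;
  and \<open>ln (N / (N - m))\<close> is at most \<open>a\<close>.\<close>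

lemma ln_Q_near:
  assumes m: "m < M"
  shows "\<bar>ln (Q m * (N / (N - real m))) + s * real n * (q m)\<^sup>2\<bar> \<le> 36 * a + 2 * real n * a ^ 4"
proof -
  define y where "y = s * (q m)\<^sup>2"
  define P where "P = (1 - y) ^ n"
  have Q: "1/2 \<le> Q m" "\<bar>Q m - P\<bar> \<le> 35/2 * a" using Q_bounds[of m] m by (simp_all add: P_def y_def)
  have qa: "0 \<le> q m" "q m \<le> a / 2" using q_nonneg q_le m by auto
  have y: "0 \<le> y" "y \<le> a\<^sup>2"
  proof -
    show "0 \<le> y" using s by (simp add: y_def)
    have "y \<le> (q m)\<^sup>2" unfolding y_def using s by (intro mult_left_le_one_le) auto
    also have "\<dots> \<le> a\<^sup>2" using qa a_pos by (intro power_mono) auto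
    finally show "y \<le> a\<^sup>2" .
  qed
  have na: "real n * a\<^sup>2 \<le> 1/2" using a1 a_pos by linarith
  have a2: "a\<^sup>2 \<le> 1/2"
  proof -
    have "1 * a\<^sup>2 \<le> real n * a\<^sup>2" using n by (intro mult_right_mono) auto
    then show ?thesis using na by linarith
  qed
  have P: "1/2 \<le> P"
  proof -
    have "1 + real n * (- y) \<le> (1 + (- y)) ^ n"
      by (rule Bernoulli_inequality) (use y a2 in linarith)
    moreover have "real n * y \<le> real n * a\<^sup>2" using y by (intro mult_left_mono) auto
    ultimately show ?thesis using na by (simp add: P_def)
  qed
  have 1: "\<bar>ln (Q m) - ln P\<bar> \<le> 35 * a"
  proof -
    have QP: "2 * \<bar>Q m - P\<bar> \<le> 35 * a" using Q(2) by simp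
    have "ln (Q m) - ln P \<le> (Q m - P) / P" using Q P by (intro ln_diff_le) auto
    also have "\<dots> \<le> \<bar>Q m - P\<bar> / (1/2)" using P by (intro frac_le) auto
    also have "\<dots> = 2 * \<bar>Q m - P\<bar>" by simp
    also note QP
    finally have u: "ln (Q m) - ln P \<le> 35 * a" .
    have "ln P - ln (Q m) \<le> (P - Q m) / Q m" using Q P by (intro ln_diff_le) auto
    also have "\<dots> \<le> \<bar>Q m - P\<bar> / (1/2)" using Q by (intro frac_le) auto
    also have "\<dots> = 2 * \<bar>Q m - P\<bar>" by simp
    also note QP
    finally have "- (ln (Q m) - ln P) \<le> 35 * a" by simp
    with u show ?thesis by (rule abs_leI)
  qed
  have 2: "\<bar>ln P + real n * y\<bar> \<le> 2 * real n * a ^ 4"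
  proof -
    have "ln P = real n * ln (1 - y)" using y a2 by (simp add: P_def ln_realpow)
    then have "ln P + real n * y = real n * (ln (1 + (- y)) - (- y))" by (simp add: algebra_simps)
    also have "\<bar>\<dots>\<bar> = real n * \<bar>ln (1 + (- y)) - (- y)\<bar>" by (simp add: abs_mult)
    also have "\<dots> \<le> real n * (2 * (- y)\<^sup>2)"
      using y a2 by (intro mult_left_mono abs_ln_one_plus_x_minus_x_bound) auto
    also have "\<dots> \<le> real n * (2 * (a\<^sup>2)\<^sup>2)"
    proof -
      have "(- y)\<^sup>2 \<le> (a\<^sup>2)\<^sup>2" using y power_mono[of y "a\<^sup>2" 2] by simp
      then show ?thesis by (intro mult_left_mono) auto
    qed
    finally show ?thesis by (simp add: power_mult [symmetric])
  qed
  have Nm: "N - real m \<ge> N / 2" "N - real m > 0" using M_le(1) m N_pos by linarith+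
  have 3: "\<bar>ln (N / (N - real m))\<bar> \<le> a"
  proof -
    have "1 \<le> N / (N - real m)" using Nm by simp
    then have "0 \<le> ln (N / (N - real m))" by simp
    moreover have "ln (N / (N - real m)) \<le> N / (N - real m) - 1"
      using Nm N_pos by (intro ln_le_minus_one) auto
    moreover have "N / (N - real m) - 1 = real m / (N - real m)" using Nm by (simp add: field_simps)
    moreover have "real m / (N - real m) \<le> real m / (N / 2)"
      using Nm N_pos by (intro divide_left_mono) auto
    moreover have "real m / (N / 2) = 2 * q m" by (simp add: q_def)
    ultimately show ?thesis using qa by linarith
  qed
  have "ln (Q m * (N / (N - real m))) = ln (Q m) + ln (N / (N - real m))"
    using Q Nm N_pos by (intro ln_mult_pos) auto
  moreover have "s * real n * (q m)\<^sup>2 = real n * y" by (simp add: y_def)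
  ultimately show ?thesis using 1 2 3 by linarith
qed

lemma ln_mgf_near:
  assumes "m \<le> M"
  shows "\<bar>ln (mgf s n m) + s * real n * (\<Sum>i<m. (q i)\<^sup>2)\<bar> \<le> real m * (36 * a + 2 * real n * a ^ 4)"
  using assms
proof (induction m)
  case 0
  then show ?case by (simp add: mgf_eq Z_0)
next
  case (Suc m)
  have Q: "0 < Q m" using Q_bounds(1)[of m] Suc.prems by simp
  have Nm: "N - real m > 0" using M_le(1) Suc.prems N_pos by linarith
  have "ln (mgf s n (Suc m)) = ln (mgf s n m) + ln (Q m * (N / (N - real m)))"
    unfolding mgf_Suc[OF Suc.prems] using mgf_pos[of m] Suc.prems Q Nm N_pos by (intro ln_mult_pos) auto
  moreover have "s * real n * (\<Sum>i<Suc m. (q i)\<^sup>2) = s * real n * (\<Sum>i<m. (q i)\<^sup>2) + s * real n * (q m)\<^sup>2"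
    by (simp add: distrib_left)
  moreover have "real (Suc m) * (36 * a + 2 * real n * a ^ 4)
      = real m * (36 * a + 2 * real n * a ^ 4) + (36 * a + 2 * real n * a ^ 4)"
    by (simp add: distrib_right)
  moreover have "\<bar>ln (Q m * (N / (N - real m))) + s * real n * (q m)\<^sup>2\<bar> \<le> 36 * a + 2 * real n * a ^ 4"
    using ln_Q_near[of m] Suc.prems by simp
  ultimately show ?case using Suc by linarith
qed

lemma sum_q_squares:
  "(\<Sum>i<m. (q i)\<^sup>2) = real m * (real m - 1) * (2 * real m - 1) / (6 * N\<^sup>2)"
proof -
  have "(\<Sum>i<m. (real i)\<^sup>2) = real m * (real m - 1) * (2 * real m - 1) / 6"
    by (induction m) (auto simp: field_simps power2_eq_square)
  moreover have "(\<Sum>i<m. (q i)\<^sup>2) = (\<Sum>i<m. (real i)\<^sup>2) / N\<^sup>2"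
    by (simp add: q_def power_divide sum_divide_distrib)
  ultimately show ?thesis by (simp only: divide_divide_eq_left)
qed

end

section \<open>Limit of the moment generating function\<close>

lemma edge_count_bounds:
  assumes "b > 0"
  shows "real (edge_count b n) \<le> b * real n powr (3/2) / 2"
    and "b * real n powr (3/2) / 2 - 1 < real (edge_count b n)"
proof -
  have "0 \<le> b * real n powr (3/2) / 2" using assms by simp
  then show "real (edge_count b n) \<le> b * real n powr (3/2) / 2"
    "b * real n powr (3/2) / 2 - 1 < real (edge_count b n)"
    unfolding edge_count_def by linarith+
qed

lemma edge_count_tendsto:
  assumes "b > 0"
  shows "(\<lambda>n. real (edge_count b n) / real n powr (3/2)) \<longlonglongrightarrow> b / 2"
proof (rule tendsto_sandwich[of "\<lambda>n. b / 2 - 1 / real n powr (3/2)" _ _ "\<lambda>n. b / 2"])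
  show "\<forall>\<^sub>F n in sequentially. b / 2 - 1 / real n powr (3/2) \<le> real (edge_count b n) / real n powr (3/2)"
    using eventually_gt_at_top[of 0]
  proof eventually_elim
    case (elim n)
    have "(b * real n powr (3/2) / 2 - 1) / real n powr (3/2) \<le> real (edge_count b n) / real n powr (3/2)"
      using edge_count_bounds(2)[OF assms, of n] by (intro divide_right_mono) auto
    then show ?case using elim by (simp add: diff_divide_distrib)
  qed
  show "\<forall>\<^sub>F n in sequentially. real (edge_count b n) / real n powr (3/2) \<le> b / 2"
    using eventually_gt_at_top[of 0]
  proof eventually_elim
    case (elim n)
    have "real (edge_count b n) / real n powr (3/2) \<le> (b * real n powr (3/2) / 2) / real n powr (3/2)"
      using edge_count_bounds(1)[OF assms, of n] by (intro divide_right_mono) auto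
    then show ?case using elim by simp
  qed
  show "(\<lambda>n. b / 2 - 1 / real n powr (3/2)) \<longlonglongrightarrow> b / 2" by real_asymp
qed simp

lemma card_edges: "real (card (nsets {..<n} 2)) = real n * (real n - 1) / 2"
proof -
  have "real (n choose 2) = real n * (real n - 1) / 2"
    by (cases n) (auto simp: choose_two real_of_nat_div field_simps)
  then show ?thesis by (simp add: card_nsets)
qed

text \<open>The edge density is about \<open>b / sqrt n\<close>, so small \<open>b\<close> gives the
  locale assumptions for large \<open>n\<close>. With \<open>m\<close> about
  \<open>b * n powr (3/2) / 2\<close> and \<open>N\<close> about \<open>n\<^sup>2 / 2\<close>, the
  leading term \<open>s * n * m ^ 3 / (3 * N\<^sup>2)\<close> has the stated limit, and the error of
  \<open>ln_mgf_near\<close> is smaller by a factor of order \<open>1 / sqrt n\<close>.\<close>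

lemma mgf_asymptotics:
  fixes b s :: real
  assumes b: "0 < b" "b \<le> 1/20" and s: "0 \<le> s" "s \<le> 1"
  shows "\<forall>\<^sub>F n in sequentially. mgf s n (edge_count b n) > 0"
    and "(\<lambda>n. ln (mgf s n (edge_count b n)) / real n powr (3/2)) \<longlonglongrightarrow> - (s * b ^ 3 / 6)"
proof -
  define V where "V = (\<lambda>n. real n powr (3/2))"
  define E where "E = (\<lambda>n. real n * (real n - 1) / 2)"
  define M where "M = (\<lambda>n. edge_count b n)"
  define u where "u = (\<lambda>n. real (M n) / V n)"
  define \<alpha> where alpha_def: "\<alpha> = (\<lambda>n. 2 * (real (M n) / E n))"
  \<comment> \<open>For positive \<open>n\<close> this equals \<open>sqrt n * \<alpha> n\<close>.
    Its finite limit \<open>2 * b\<close> decides all the size conditions.\<close>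
  define t where "t = (\<lambda>n. 2 * u n * ((real n)\<^sup>2 / E n))"
  have u: "u \<longlonglongrightarrow> b / 2"
    using edge_count_tendsto[OF b(1)] by (simp add: u_def V_def M_def)
  have E: "(\<lambda>n. (real n)\<^sup>2 / E n) \<longlonglongrightarrow> 2"
    unfolding E_def by real_asymp
  have t: "t \<longlonglongrightarrow> 2 * b"
    unfolding t_def by (rule tendsto_eq_intros u E refl | simp)+
  have V: "V n = real n * sqrt (real n)" for n
  proof (cases "n = 0")
    case False
    then have "real n powr (1 + 1/2) = real n * sqrt (real n)"
      by (subst powr_add) (simp add: powr_half_sqrt)
    then show ?thesis by (simp add: V_def)
  qed (simp add: V_def)
  have alpha_t: "\<alpha> n = t n / sqrt (real n)" if "n > 0" for n
    using that by (simp add: alpha_def t_def u_def V power2_eq_square field_simps)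
  have na: "real n * (\<alpha> n)\<^sup>2 = (t n)\<^sup>2" if "n > 0" for n
    using that by (simp add: alpha_t power_divide)
  have "(\<lambda>n. t n / sqrt (real n)) \<longlonglongrightarrow> 0"
    by (rule real_tendsto_divide_at_top[OF t]) real_asymp
  then have \<alpha>: "\<alpha> \<longlonglongrightarrow> 0"
    by (rule Lim_transform_eventually) (use eventually_gt_at_top[of 0] in eventually_elim, simp add: alpha_t)
  have c1: "\<forall>\<^sub>F n in sequentially. \<alpha> n + (t n)\<^sup>2 < 1/2"
  proof (rule order_tendstoD(2))
    show "(\<lambda>n. \<alpha> n + (t n)\<^sup>2) \<longlonglongrightarrow> 0 + (2 * b)\<^sup>2" by (intro tendsto_intros \<alpha> t)
    have "(2 * b)\<^sup>2 \<le> (1/10)\<^sup>2" using b by (intro power_mono) auto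
    then show "0 + (2 * b)\<^sup>2 < 1/2" by (simp add: power2_eq_square)
  qed
  have c2: "\<forall>\<^sub>F n in sequentially. exp (16 * (t n)\<^sup>2) < 3/2"
  proof (rule order_tendstoD(2))
    show "(\<lambda>n. exp (16 * (t n)\<^sup>2)) \<longlonglongrightarrow> exp (16 * (2 * b)\<^sup>2)" by (intro tendsto_intros t)
    \<comment> \<open>Since \<open>b \<le> 1/20\<close>, this is at most 16/100, and the quadratic
      bound for the exponential at 1/5 is 1.24.\<close>
    define x where "x = 16 * (2 * b)\<^sup>2"
    have "(2 * b)\<^sup>2 \<le> (1/10)\<^sup>2" using b by (intro power_mono) auto
    then have x: "0 \<le> x" "x \<le> 1/5" by (auto simp: x_def power2_eq_square)
    then have "exp x \<le> 1 + x + x\<^sup>2" by (intro exp_bound) auto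
    moreover have "x\<^sup>2 \<le> (1/5)\<^sup>2" using x by (intro power_mono) auto
    ultimately show "exp (16 * (2 * b)\<^sup>2) < 3/2" using x unfolding x_def[symmetric] by (simp add: power2_eq_square)
  qed
  have c3: "\<forall>\<^sub>F n in sequentially. (t n)\<^sup>2 * ((real n - 1) / 2) \<ge> 1"
  proof -
    have "filterlim (\<lambda>n. (t n)\<^sup>2 * ((real n - 1) / 2)) at_top sequentially"
    proof (rule filterlim_tendsto_pos_mult_at_top)
      show "(\<lambda>n. (t n)\<^sup>2) \<longlonglongrightarrow> (2 * b)\<^sup>2" by (intro tendsto_intros t)
      show "0 < (2 * b)\<^sup>2" using b by simp
    qed real_asymp
    then show ?thesis unfolding filterlim_at_top by blast
  qed
  have loc: "\<forall>\<^sub>F n in sequentially. sparse_tilted_graphs s n (M n) (\<alpha> n)"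
    using c1 c2 c3 eventually_ge_at_top[of 2]
  proof eventually_elim
    case (elim n)
    have "tilted_graphs s n" using s elim by unfold_locales auto
    then interpret tilted_graphs s n .
    have N_eq: "E n = real (card K)" unfolding E_def using card_edges[of n] by simp
    show ?case
    proof
      show "\<alpha> n = 2 * q (M n)" by (simp add: alpha_def q_def N_eq N_def)
      show "\<alpha> n + real n * (\<alpha> n)\<^sup>2 \<le> 1/2" using elim na[of n] by simp
      show "exp (16 * real n * (\<alpha> n)\<^sup>2) \<le> 3/2" using elim na[of n] by (simp add: mult.assoc)
      have "(t n)\<^sup>2 * ((real n - 1) / 2) = E n * (\<alpha> n)\<^sup>2"
        using elim by (simp add: E_def flip: na)
      then show "1 \<le> tilted_graphs.N n * (\<alpha> n)\<^sup>2"
        using elim by (simp only: N_def N_eq)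
    qed
  qed
  show "\<forall>\<^sub>F n in sequentially. mgf s n (edge_count b n) > 0"
    using loc by eventually_elim (simp add: sparse_tilted_graphs.mgf_pos M_def)
  define err where "err = (\<lambda>n. u n * (36 * \<alpha> n + 2 * (t n)\<^sup>2 * (\<alpha> n)\<^sup>2))"
  \<comment> \<open>The closed form of \<open>sum_q_squares\<close> in terms of convergent
    quantities; the limit is \<open>s * (b/2) * (b/2) * b * 4 / 6\<close>.\<close>
  define main where "main = (\<lambda>n. s * (u n * (u n - 1 / V n) * (2 * u n - 1 / V n) * ((real n)\<^sup>2 / E n)\<^sup>2 / 6))"
  have near: "\<forall>\<^sub>F n in sequentially. \<bar>ln (mgf s n (M n)) / V n + main n\<bar> \<le> err n"
    using loc eventually_ge_at_top[of 2]
  proof eventually_elim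
    case (elim n)
    interpret sparse_tilted_graphs s n "M n" "\<alpha> n" by (rule elim)
    have N_eq: "tilted_graphs.N n = E n"
      unfolding E_def using card_edges[of n] by (simp add: N_def)
    have V0: "V n > 0" using elim by (simp add: V)
    have V2: "V n ^ 2 = real n ^ 3"
      by (simp add: V power_mult_distrib power2_eq_square power3_eq_cube)
    have "s * real n * (\<Sum>i<M n. (q i)\<^sup>2) / V n = main n"
    proof -
      have "u n * (u n - 1 / V n) * (2 * u n - 1 / V n) = real (M n) * (real (M n) - 1) * (2 * real (M n) - 1) / V n ^ 3"
        using V0 by (simp add: u_def field_simps power3_eq_cube)
      moreover have "((real n)\<^sup>2 / E n)\<^sup>2 = real n * V n ^ 2 / (E n)\<^sup>2"
        by (simp add: V2 power_divide flip: power_Suc power_mult)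
      ultimately have "main n = s * (real (M n) * (real (M n) - 1) * (2 * real (M n) - 1) / V n ^ 3
          * (real n * V n ^ 2 / (E n)\<^sup>2) / 6)" by (simp add: main_def)
      also have "\<dots> = s * real n * (real (M n) * (real (M n) - 1) * (2 * real (M n) - 1) / (6 * (E n)\<^sup>2)) / V n"
        using V0 by (simp add: power3_eq_cube power2_eq_square mult_ac)
      finally show ?thesis by (simp add: sum_q_squares N_eq)
    qed
    then have "ln (mgf s n (M n)) / V n + main n = (ln (mgf s n (M n)) + s * real n * (\<Sum>i<M n. (q i)\<^sup>2)) / V n"
      by (simp add: add_divide_distrib)
    also have "\<bar>\<dots>\<bar> = \<bar>ln (mgf s n (M n)) + s * real n * (\<Sum>i<M n. (q i)\<^sup>2)\<bar> / V n"
      using V0 by (simp add: abs_divide)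
    also have "\<dots> \<le> real (M n) * (36 * \<alpha> n + 2 * real n * (\<alpha> n) ^ 4) / V n"
      using ln_mgf_near[of "M n"] V0 by (intro divide_right_mono) auto
    also have "2 * real n * (\<alpha> n) ^ 4 = 2 * (t n)\<^sup>2 * (\<alpha> n)\<^sup>2"
      using na[of n] elim by (simp add: mult.assoc flip: na power_add)
    finally show ?case by (simp add: err_def u_def)
  qed
  have err: "err \<longlonglongrightarrow> 0"
    unfolding err_def by (rule tendsto_eq_intros u \<alpha> t refl | simp)+
  have V_inf: "(\<lambda>n. 1 / V n) \<longlonglongrightarrow> 0" unfolding V_def by real_asymp
  have main: "main \<longlonglongrightarrow> s * b ^ 3 / 6"
    unfolding main_def
    by (rule tendsto_eq_intros u V_inf E refl | simp add: power3_eq_cube power2_eq_square)+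
  have "(\<lambda>n. ln (mgf s n (M n)) / V n + main n) \<longlonglongrightarrow> 0"
    using near by (intro Lim_null_comparison[OF _ err]) simp
  from tendsto_diff[OF this main] show "(\<lambda>n. ln (mgf s n (edge_count b n)) / real n powr (3/2)) \<longlonglongrightarrow> - (s * b ^ 3 / 6)"
    by (simp add: M_def V_def)
qed

section \<open>The lower tail for small \<open>b\<close>\<close>

lemma card_graphs_containing:
  assumes "A \<subseteq> nsets {..<n} 2" "card A \<le> m"
  shows "card {G \<in> graphs n m. A \<subseteq> G} = (card (nsets {..<n} 2) - card A choose (m - card A))"
proof -
  let ?K = "nsets {..<n} 2"
  have finA: "finite A" using assms(1) finite_edges by (rule finite_subset)
  have fin: "finite E" if "E \<subseteq> ?K" for E using that finite_edges by (rule finite_subset)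
  have "bij_betw (\<lambda>G. G - A) {G \<in> graphs n m. A \<subseteq> G} {B. B \<subseteq> ?K - A \<and> card B = m - card A}"
  proof (rule bij_betwI[where g = "\<lambda>B. B \<union> A"])
    show "(\<lambda>G. G - A) \<in> {G \<in> graphs n m. A \<subseteq> G} \<rightarrow> {B. B \<subseteq> ?K - A \<and> card B = m - card A}"
      using finA by (auto simp: graphs_def card_Diff_subset)
    show "(\<lambda>B. B \<union> A) \<in> {B. B \<subseteq> ?K - A \<and> card B = m - card A} \<rightarrow> {G \<in> graphs n m. A \<subseteq> G}"
    proof (rule funcsetI, clarify)
      fix B assume B: "B \<subseteq> ?K - A" "card B = m - card A"
      then have "finite B" by (intro fin) auto
      then have "card (B \<union> A) = card B + card A" using B finA by (intro card_Un_disjoint) auto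
      then show "B \<union> A \<in> graphs n m \<and> A \<subseteq> B \<union> A" using B assms by (auto simp: graphs_def)
    qed
  qed auto
  then have "card {G \<in> graphs n m. A \<subseteq> G} = card {B. B \<subseteq> ?K - A \<and> card B = m - card A}"
    by (rule bij_betw_same_card)
  also have "\<dots> = (card (?K - A) choose (m - card A))"
    by (rule n_subsets) (simp add: finite_edges)
  also have "card (?K - A) = card ?K - card A"
    using finA assms by (intro card_Diff_subset) auto
  finally show ?thesis .
qed

lemma binomial_ratio_3:
  "real (N + 3) * (real N + 2) * (real N + 1) * real (N choose m)
    = (real m + 3) * (real m + 2) * (real m + 1) * real ((N + 3) choose (m + 3))"
proof -
  have step: "real (Suc k) * real (Suc j choose Suc k) = real (Suc j) * real (j choose k)" for j k
    by (simp only: Suc_times_binomial flip: of_nat_mult)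
  have "real (Suc (Suc (Suc m))) * real (Suc (Suc m)) * real (Suc m) * real (Suc (Suc (Suc N)) choose Suc (Suc (Suc m)))
      = real (Suc (Suc (Suc N))) * real (Suc (Suc N)) * real (Suc N) * real (N choose m)"
    using step[of "Suc (Suc m)" "Suc (Suc N)"] step[of "Suc m" "Suc N"] step[of m N] by algebra
  then show ?thesis by (simp add: eval_nat_numeral algebra_simps)
qed

text \<open>By linearity, every triple of vertices contributes the probability that its three edges
  are present, a ratio of binomials given by \<open>binomial_ratio_3\<close>.\<close>

lemma expectation_triangles:
  assumes m: "m \<le> card (nsets {..<n} 2)" "3 \<le> m"
  defines "N \<equiv> real (card (nsets {..<n} 2))"
  shows "measure_pmf.expectation (Gnm n m) (\<lambda>G. real (triangles n G))
    = real (n choose 3) * (real m * (real m - 1) * (real m - 2)) / (N * (N - 1) * (N - 2))"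
proof -
  let ?K = "nsets {..<n} 2"
  obtain k where k: "m = k + 3" using m(2) by (metis add.commute le_Suc_ex)
  obtain j where j: "card ?K = j + 3" using m by (metis add.commute le_Suc_ex order_trans)
  have T: "real (card {G \<in> graphs n m. nsets T 2 \<subseteq> G}) = real (j choose k)" if "T \<in> nsets {..<n} 3" for T
  proof -
    have "nsets T 2 \<subseteq> ?K" using that by (intro nsets_mono) (auto simp: nsets_def)
    moreover have "card (nsets T 2) = 3" using that by (simp add: card_nsets) (simp add: nsets_def choose_two)
    ultimately show ?thesis using card_graphs_containing[of "nsets T 2" n m] m k j by simp
  qed
  have "(\<Sum>G\<in>graphs n m. real (triangles n G)) = (\<Sum>G\<in>graphs n m. \<Sum>T\<in>nsets {..<n} 3. of_bool (nsets T 2 \<subseteq> G))"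
    unfolding triangles_def by (intro sum.cong refl) (simp add: finite_imp_finite_nsets Int_def)
  also have "\<dots> = (\<Sum>T\<in>nsets {..<n} 3. \<Sum>G\<in>graphs n m. of_bool (nsets T 2 \<subseteq> G))"
    by (rule sum.swap)
  also have "\<dots> = (\<Sum>T\<in>nsets {..<n} 3. real (j choose k))"
    by (intro sum.cong refl) (simp add: finite_graphs Int_def flip: T)
  also have "\<dots> = real (n choose 3) * real (j choose k)" by (simp add: card_nsets)
  finally have "measure_pmf.expectation (Gnm n m) (\<lambda>G. real (triangles n G))
      = real (n choose 3) * real (j choose k) / real ((j + 3) choose (k + 3))"
    using m by (simp add: expectation_Gnm card_graphs j k del: card_nsets)
  also have "\<dots> = real (n choose 3) * (real m * (real m - 1) * (real m - 2)) / (N * (N - 1) * (N - 2))"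
  proof -
    have "k \<le> j" using m k j by simp
    then have "real ((j + 3) choose (k + 3)) > 0" by simp
    then have "real (j choose k) / real ((j + 3) choose (k + 3))
        = ((real k + 3) * (real k + 2) * (real k + 1)) / (real (j + 3) * (real j + 2) * (real j + 1))"
      using binomial_ratio_3[of j k] by (simp add: frac_eq_eq mult_ac del: of_nat_add)
    then show ?thesis unfolding N_def j k times_divide_eq_right[symmetric] by (simp add: add.commute)
  qed
  finally show ?thesis .
qed

lemma expectation_triangles_tendsto:
  assumes b: "b > 0"
  shows "(\<lambda>n. measure_pmf.expectation (Gnm n (edge_count b n)) (\<lambda>G. real (triangles n G)) / real n powr (3/2))
    \<longlonglongrightarrow> b ^ 3 / 6"
proof -
  define V where "V = (\<lambda>n. real n powr (3/2))"
  define u where "u = (\<lambda>n. real (edge_count b n) / V n)"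
  define N where "N = (\<lambda>n. real n * (real n - 1) / 2)"
  define c where "c = (\<lambda>n. (real n * (real n - 1) * (real n - 2) / 6) * V n ^ 2 / (N n * (N n - 1) * (N n - 2)))"
  have u: "u \<longlonglongrightarrow> b / 2"
    using edge_count_tendsto[OF b] by (simp add: u_def V_def)
  \<comment> \<open>To leading order \<open>n ^ 6 / 6\<close> over \<open>n ^ 6 / 8\<close>;
    together with \<open>(b / 2) ^ 3\<close> this yields \<open>b ^ 3 / 6\<close>.\<close>
  have c: "c \<longlonglongrightarrow> 8 / 6"
    unfolding c_def V_def N_def by real_asymp
  have V: "(\<lambda>n. 1 / V n) \<longlonglongrightarrow> 0" "(\<lambda>n. 2 / V n) \<longlonglongrightarrow> 0"
    unfolding V_def by real_asymp+
  have "(\<lambda>n. u n * (u n - 1 / V n) * (u n - 2 / V n) * c n) \<longlonglongrightarrow> b ^ 3 / 6"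
    by (rule tendsto_eq_intros u V c refl | simp add: power3_eq_cube)+
  moreover have "\<forall>\<^sub>F n in sequentially. u n * (u n - 1 / V n) * (u n - 2 / V n) * c n
      = measure_pmf.expectation (Gnm n (edge_count b n)) (\<lambda>G. real (triangles n G)) / V n"
  proof -
    have "\<forall>\<^sub>F n in sequentially. b * real n powr (3/2) / 2 \<le> N n"
      "\<forall>\<^sub>F n in sequentially. 3 \<le> b * real n powr (3/2) / 2 - 1"
      using b unfolding N_def by real_asymp+
    then show ?thesis using eventually_ge_at_top[of 3]
    proof eventually_elim
      case (elim n)
      define M where "M = real (edge_count b n)"
      have N: "N n = real (card (nsets {..<n} 2))" unfolding N_def by (simp only: card_edges)
      have "edge_count b n \<le> card (nsets {..<n} 2)" "3 \<le> edge_count b n"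
        using edge_count_bounds[OF b, of n] elim N by linarith+
      note E = expectation_triangles[OF this, folded N]
      have V0: "V n > 0" using elim by (simp add: V_def)
      have n3: "real (n choose 3) = real n * (real n - 1) * (real n - 2) / 6"
        using elim by (simp add: binomial_gbinomial gbinomial_prod_rev eval_nat_numeral of_nat_diff)
      have "u n * (u n - 1 / V n) * (u n - 2 / V n) = M * (M - 1) * (M - 2) / V n ^ 3"
        using V0 by (simp add: u_def M_def field_simps power3_eq_cube)
      then have "u n * (u n - 1 / V n) * (u n - 2 / V n) * c n
          = real (n choose 3) * (M * (M - 1) * (M - 2)) / (N n * (N n - 1) * (N n - 2)) * (V n ^ 2 / V n ^ 3)"
        by (simp add: c_def n3 mult_ac)
      also have "V n ^ 2 / V n ^ 3 = 1 / V n" using V0 by (simp add: power2_eq_square power3_eq_cube)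
      finally show ?case by (simp add: E M_def)
    qed
  qed
  ultimately show ?thesis unfolding V_def by (rule Lim_transform_eventually)
qed

section \<open>Exponential tilting\<close>

lemma prob_Gnm:
  "measure_pmf.prob (Gnm n m) A = measure_pmf.expectation (Gnm n m) (\<lambda>G. of_bool (G \<in> A))"
proof -
  have "(\<lambda>G. of_bool (G \<in> A)) = (indicator A :: _ \<Rightarrow> real)" by (auto simp: indicator_def)
  then show ?thesis by simp
qed

lemma expectation_Gnm_mono:
  fixes f g :: "nat set set \<Rightarrow> real"
  assumes "m \<le> card (nsets {..<n} 2)" "\<And>G. f G \<le> g G"
  shows "measure_pmf.expectation (Gnm n m) f \<le> measure_pmf.expectation (Gnm n m) g"
  unfolding expectation_Gnm[OF assms(1)] using assms(2) by (intro divide_right_mono sum_mono) auto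

lemma expectation_Gnm_add:
  fixes f g :: "nat set set \<Rightarrow> real"
  assumes "m \<le> card (nsets {..<n} 2)"
  shows "measure_pmf.expectation (Gnm n m) (\<lambda>G. f G + g G)
    = measure_pmf.expectation (Gnm n m) f + measure_pmf.expectation (Gnm n m) g"
  unfolding expectation_Gnm[OF assms] by (simp add: sum.distrib add_divide_distrib)

text \<open>Markov's inequality for \<open>\<eta> ^ X\<close>: on the event this is at least
  \<open>\<eta> powr (\<eta> * \<mu>)\<close>, as the base is below 1. Among the bases \<sigma>, the
  choice \<eta> minimises the limiting exponent, proportional to
  \<open>\<sigma> - 1 - \<eta> * ln \<sigma>\<close>.\<close>

lemma lower_tail_upper:
  assumes m: "m \<le> card (nsets {..<n} 2)" and \<eta>: "0 < \<eta>" "\<eta> < 1"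
  defines "\<mu> \<equiv> measure_pmf.expectation (Gnm n m) (\<lambda>G. real (triangles n G))"
  shows "lower_tail_prob \<eta> n m * \<eta> powr (\<eta> * \<mu>) \<le> mgf (1 - \<eta>) n m"
proof -
  have "measure_pmf.expectation (Gnm n m) (\<lambda>G. of_bool (real (triangles n G) \<le> \<eta> * \<mu>) * \<eta> powr (\<eta> * \<mu>))
      \<le> measure_pmf.expectation (Gnm n m) (\<lambda>G. \<eta> ^ triangles n G)"
  proof (rule expectation_Gnm_mono[OF m])
    fix G
    have "\<eta> powr (\<eta> * \<mu>) \<le> \<eta> powr (real (triangles n G))" if "real (triangles n G) \<le> \<eta> * \<mu>"
      using that \<eta> by (intro powr_mono') auto
    then show "of_bool (real (triangles n G) \<le> \<eta> * \<mu>) * \<eta> powr (\<eta> * \<mu>) \<le> \<eta> ^ triangles n G"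
      using \<eta> by (simp add: powr_realpow)
  qed
  then show ?thesis by (simp add: lower_tail_prob_def prob_Gnm mgf_def \<mu>_def)
qed

text \<open>Under the tilt \<open>\<sigma>\<^sup>X\<close> the count \<open>X\<close> concentrates near \<open>\<sigma> * \<mu>\<close>; the last two terms bound the
  tilted mass of \<open>X > \<eta> * \<mu>\<close> and of \<open>X \<le> \<beta> * \<mu>\<close>.\<close>

lemma lower_tail_lower:
  assumes m: "m \<le> card (nsets {..<n} 2)" and \<eta>: "0 < \<beta>" "\<beta> < \<sigma>" "\<sigma> < \<eta>" "\<eta> < 1"
  defines "\<mu> \<equiv> measure_pmf.expectation (Gnm n m) (\<lambda>G. real (triangles n G))"
  shows "mgf (1 - \<sigma>) n m \<le> lower_tail_prob \<eta> n m * \<sigma> powr (\<beta> * \<mu>)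
    + mgf (1 - \<eta>) n m * (\<sigma> / \<eta>) powr (\<eta> * \<mu>) + mgf (1 - \<beta>) n m * (\<sigma> / \<beta>) powr (\<beta> * \<mu>)"
proof -
  have "measure_pmf.expectation (Gnm n m) (\<lambda>G. \<sigma> ^ triangles n G)
      \<le> measure_pmf.expectation (Gnm n m) (\<lambda>G. of_bool (real (triangles n G) \<le> \<eta> * \<mu>) * \<sigma> powr (\<beta> * \<mu>)
         + \<eta> ^ triangles n G * (\<sigma> / \<eta>) powr (\<eta> * \<mu>) + \<beta> ^ triangles n G * (\<sigma> / \<beta>) powr (\<beta> * \<mu>))"
  proof (rule expectation_Gnm_mono[OF m])
    fix G
    define X where "X = triangles n G"
    \<comment> \<open>Retilting turns each tail into a Markov bound at its threshold: the base
      \<open>\<sigma> / \<tau>\<close> exceeds 1 for \<open>\<tau> = \<beta>\<close> and is below 1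
      for \<open>\<tau> = \<eta>\<close>.\<close>
    have tilt: "\<sigma> ^ X = \<tau> ^ X * (\<sigma> / \<tau>) powr real X" if "\<tau> > 0" for \<tau>
      using that \<eta> by (simp add: powr_realpow power_divide)
    have nn: "0 \<le> \<eta> ^ X * (\<sigma> / \<eta>) powr (\<eta> * \<mu>)" "0 \<le> \<beta> ^ X * (\<sigma> / \<beta>) powr (\<beta> * \<mu>)"
      "0 \<le> of_bool (real X \<le> \<eta> * \<mu>) * \<sigma> powr (\<beta> * \<mu>)"
      using \<eta> by simp_all
    consider "real X \<le> \<beta> * \<mu>" | "real X > \<eta> * \<mu>" | "\<beta> * \<mu> < real X" "real X \<le> \<eta> * \<mu>" by linarith
    then show "\<sigma> ^ X \<le> of_bool (real X \<le> \<eta> * \<mu>) * \<sigma> powr (\<beta> * \<mu>)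
         + \<eta> ^ X * (\<sigma> / \<eta>) powr (\<eta> * \<mu>) + \<beta> ^ X * (\<sigma> / \<beta>) powr (\<beta> * \<mu>)"
    proof cases
      case 1
      then have "(\<sigma> / \<beta>) powr real X \<le> (\<sigma> / \<beta>) powr (\<beta> * \<mu>)"
        using \<eta> by (intro powr_mono) auto
      then have "\<sigma> ^ X \<le> \<beta> ^ X * (\<sigma> / \<beta>) powr (\<beta> * \<mu>)"
        using tilt[of \<beta>] \<eta> by (simp add: mult_left_mono)
      then show ?thesis using nn by linarith
    next
      case 2
      then have "(\<sigma> / \<eta>) powr real X \<le> (\<sigma> / \<eta>) powr (\<eta> * \<mu>)"
        using \<eta> by (intro powr_mono') auto
      then have "\<sigma> ^ X \<le> \<eta> ^ X * (\<sigma> / \<eta>) powr (\<eta> * \<mu>)"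
        using tilt[of \<eta>] \<eta> by (simp add: mult_left_mono)
      then show ?thesis using nn by linarith
    next
      case 3
      then have "\<sigma> powr real X \<le> \<sigma> powr (\<beta> * \<mu>)"
        using \<eta> by (intro powr_mono') auto
      then have "\<sigma> ^ X \<le> of_bool (real X \<le> \<eta> * \<mu>) * \<sigma> powr (\<beta> * \<mu>)"
        using 3 \<eta> by (simp add: powr_realpow)
      then show ?thesis using nn by linarith
    qed
  qed
  then show ?thesis
    by (simp only: expectation_Gnm_add[OF m] lower_tail_prob_def prob_Gnm mgf_def \<mu>_def
        integral_mult_left_zero mem_Collect_eq diff_diff_eq2 add_diff_cancel_left')
qed

text \<open>A strictly smaller exponential rate beats any constant. With the constant 3, the two
  error terms of \<open>lower_tail_lower\<close> leave a third of the tilted mass.\<close>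

lemma exponential_order_less:
  fixes A B V :: "nat \<Rightarrow> real"
  assumes A: "\<forall>\<^sub>F n in sequentially. A n > 0" "(\<lambda>n. ln (A n) / V n) \<longlonglongrightarrow> x"
    and B: "\<forall>\<^sub>F n in sequentially. B n > 0" "(\<lambda>n. ln (B n) / V n) \<longlonglongrightarrow> y"
    and V: "filterlim V at_top sequentially" and "x < y"
  shows "\<forall>\<^sub>F n in sequentially. A n \<le> B n / 3"
proof -
  have "(\<lambda>n. ln (A n) / V n - ln (B n) / V n + ln 3 / V n) \<longlonglongrightarrow> x - y + 0"
    by (intro tendsto_intros A B real_tendsto_divide_at_top[OF tendsto_const V])
  then have "\<forall>\<^sub>F n in sequentially. ln (A n) / V n - ln (B n) / V n + ln 3 / V n < 0"
    using \<open>x < y\<close> by (intro order_tendstoD(2)[of _ "x - y + 0"]) auto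
  moreover have "\<forall>\<^sub>F n in sequentially. V n > 0"
    using V by (simp add: filterlim_at_top_dense)
  ultimately show ?thesis using A(1) B(1)
  proof eventually_elim
    case (elim n)
    have "(ln (A n) - ln (B n) + ln 3) / V n < 0"
      using elim by (simp add: add_divide_distrib diff_divide_distrib)
    then have "ln (A n) + ln 3 < ln (B n)" using elim by (simp add: divide_less_0_iff)
    then have "ln (A n * 3) < ln (B n)" using elim by (simp add: ln_mult_pos)
    then show ?case using elim by simp
  qed
qed

lemma ln_less_minus_one_strict: "0 < x \<Longrightarrow> x \<noteq> 1 \<Longrightarrow> ln x < x - (1 :: real)"
  using ln_le_minus_one[of x] ln_eq_minus_one[of x] by fastforce

text \<open>For positive \<eta> the upper bound is \<open>lower_tail_upper\<close>. The lower bound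
  is \<open>lower_tail_lower\<close> with \<beta> and \<sigma> close to \<eta>, where its rate
  approaches the same value.\<close>

lemma lower_tail_asymptotics:
  fixes b \<eta> :: real
  assumes b: "0 < b" "b \<le> 1/20" and \<eta>: "0 \<le> \<eta>" "\<eta> < 1"
  shows "\<forall>\<^sub>F n in sequentially. lower_tail_prob \<eta> n (edge_count b n) > 0"
    and "(\<lambda>n. ln (lower_tail_prob \<eta> n (edge_count b n)) / real n powr (3/2))
      \<longlonglongrightarrow> b ^ 3 / 6 * (\<eta> - 1 - \<eta> * ln \<eta>)"
proof -
  define L where "L = b ^ 3 / 6"
  define V where "V = (\<lambda>n. real n powr (3/2))"
  define G where "G = (\<lambda>\<sigma> n. mgf (1 - \<sigma>) n (edge_count b n))"
  define p where "p = (\<lambda>n. lower_tail_prob \<eta> n (edge_count b n))"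
  define \<mu> where "\<mu> = (\<lambda>n. measure_pmf.expectation (Gnm n (edge_count b n)) (\<lambda>G. real (triangles n G)))"
  have L: "L > 0" using b by (simp add: L_def)
  have V: "filterlim V at_top sequentially" unfolding V_def by real_asymp
  have V_pos: "\<forall>\<^sub>F n in sequentially. V n > 0" using V by (simp add: filterlim_at_top_dense)
  have \<mu>: "(\<lambda>n. \<mu> n / V n) \<longlonglongrightarrow> L"
    using expectation_triangles_tendsto[OF b(1)] by (simp add: \<mu>_def V_def L_def)
  have G_pos: "\<forall>\<^sub>F n in sequentially. G \<sigma> n > 0" if "0 \<le> \<sigma>" "\<sigma> \<le> 1" for \<sigma>
    using mgf_asymptotics(1)[OF b, of "1 - \<sigma>"] that by (simp add: G_def)
  have G_lim: "(\<lambda>n. ln (G \<sigma> n) / V n) \<longlonglongrightarrow> L * (\<sigma> - 1)" if "0 \<le> \<sigma>" "\<sigma> \<le> 1" for \<sigma>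
  proof -
    have "(\<lambda>n. ln (G \<sigma> n) / V n) \<longlonglongrightarrow> - ((1 - \<sigma>) * b ^ 3 / 6)"
      using mgf_asymptotics(2)[OF b, of "1 - \<sigma>"] that by (simp add: G_def V_def)
    also have "- ((1 - \<sigma>) * b ^ 3 / 6) = L * (\<sigma> - 1)" by (simp add: L_def field_simps)
    finally show ?thesis .
  qed
  have m_le: "\<forall>\<^sub>F n in sequentially. edge_count b n \<le> card (nsets {..<n} 2)"
  proof -
    have "\<forall>\<^sub>F n in sequentially. b * real n powr (3/2) / 2 \<le> real n * (real n - 1) / 2"
      using b by real_asymp
    then show ?thesis
    proof eventually_elim
      case (elim n)
      then have "real (edge_count b n) \<le> real (card (nsets {..<n} 2))"
        using edge_count_bounds(1)[OF b(1), of n] by (simp only: card_edges)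
      then show ?case by linarith
    qed
  qed
  have "(\<forall>\<^sub>F n in sequentially. p n > 0) \<and> (\<lambda>n. ln (p n) / V n) \<longlonglongrightarrow> L * (\<eta> - 1 - \<eta> * ln \<eta>)"
  proof (cases "\<eta> = 0")
    \<comment> \<open>The event is then that there are no triangles. Its probability is the moment
      generating function at \<open>s = 1\<close>, because \<open>0 ^ 0 = 1\<close>.\<close>
    case True
    have "p = G 0"
      using True by (auto simp: p_def G_def lower_tail_prob_def prob_Gnm mgf_def power_0_left of_bool_def)
    then show ?thesis using G_pos[of 0] G_lim[of 0] True by simp
  next
    case False
    then have \<eta>0: "\<eta> > 0" using \<eta> by simp
    have tilted: "(\<lambda>n. ln (G \<tau> n * (\<sigma> / \<tau>) powr (\<tau> * \<mu> n)) / V n) \<longlonglongrightarrow> L * (\<tau> - 1 + \<tau> * ln (\<sigma> / \<tau>))"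
      "\<forall>\<^sub>F n in sequentially. G \<tau> n * (\<sigma> / \<tau>) powr (\<tau> * \<mu> n) > 0"
      if "0 < \<tau>" "\<tau> < 1" "0 < \<sigma>" for \<sigma> \<tau>
    proof -
      have "(\<lambda>n. ln (G \<tau> n) / V n + \<tau> * (\<mu> n / V n) * ln (\<sigma> / \<tau>)) \<longlonglongrightarrow> L * (\<tau> - 1) + \<tau> * L * ln (\<sigma> / \<tau>)"
        using that by (intro tendsto_intros G_lim \<mu>) auto
      moreover have "\<forall>\<^sub>F n in sequentially. ln (G \<tau> n) / V n + \<tau> * (\<mu> n / V n) * ln (\<sigma> / \<tau>)
          = ln (G \<tau> n * (\<sigma> / \<tau>) powr (\<tau> * \<mu> n)) / V n"
        using G_pos[of \<tau>] that
        by (auto elim!: eventually_mono simp: ln_mult_pos ln_powr add_divide_distrib)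
      ultimately have "(\<lambda>n. ln (G \<tau> n * (\<sigma> / \<tau>) powr (\<tau> * \<mu> n)) / V n) \<longlonglongrightarrow> L * (\<tau> - 1) + \<tau> * L * ln (\<sigma> / \<tau>)"
        by (rule Lim_transform_eventually)
      then show "(\<lambda>n. ln (G \<tau> n * (\<sigma> / \<tau>) powr (\<tau> * \<mu> n)) / V n) \<longlonglongrightarrow> L * (\<tau> - 1 + \<tau> * ln (\<sigma> / \<tau>))"
        by (simp add: algebra_simps)
      show "\<forall>\<^sub>F n in sequentially. G \<tau> n * (\<sigma> / \<tau>) powr (\<tau> * \<mu> n) > 0"
        using G_pos[of \<tau>] that by (auto elim!: eventually_mono)
    qed
    \<comment> \<open>Strictness of \<open>ln x < x - 1\<close> at
      \<open>x = \<sigma> / \<tau>\<close> makes both tails of the tilted law exponentially smaller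
      than its total mass.\<close>
    have tilted_less: "L * (\<tau> - 1 + \<tau> * ln (\<sigma> / \<tau>)) < L * (\<sigma> - 1)" if "0 < \<tau>" "0 < \<sigma>" "\<sigma> \<noteq> \<tau>" for \<sigma> \<tau>
    proof -
      have "\<tau> * ln (\<sigma> / \<tau>) < \<tau> * (\<sigma> / \<tau> - 1)"
        using that by (intro mult_strict_left_mono ln_less_minus_one_strict) auto
      then have "\<tau> - 1 + \<tau> * ln (\<sigma> / \<tau>) < \<sigma> - 1" using that by (simp add: right_diff_distrib)
      then show ?thesis using L by (rule mult_strict_left_mono)
    qed
    have lower: "\<forall>\<^sub>F n in sequentially. G \<sigma> n / 3 \<le> p n * \<sigma> powr (\<beta> * \<mu> n)"
      if *: "0 < \<beta>" "\<beta> < \<sigma>" "\<sigma> < \<eta>" for \<beta> \<sigma>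
    proof -
      have small: "\<forall>\<^sub>F n in sequentially. G \<tau> n * (\<sigma> / \<tau>) powr (\<tau> * \<mu> n) \<le> G \<sigma> n / 3"
        if "0 < \<tau>" "\<tau> < 1" "\<sigma> \<noteq> \<tau>" for \<tau>
        using that * \<eta> by (intro exponential_order_less[OF _ tilted(1) _ G_lim V tilted_less] tilted(2) G_pos) auto
      have "\<forall>\<^sub>F n in sequentially. G \<eta> n * (\<sigma> / \<eta>) powr (\<eta> * \<mu> n) \<le> G \<sigma> n / 3"
        using * \<eta> by (intro small) auto
      moreover have "\<forall>\<^sub>F n in sequentially. G \<beta> n * (\<sigma> / \<beta>) powr (\<beta> * \<mu> n) \<le> G \<sigma> n / 3"
        using * \<eta> by (intro small) auto
      ultimately show ?thesis using m_le
      proof eventually_elim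
        case (elim n)
        then show ?case
          using lower_tail_lower[OF elim(3) * \<eta>(2)] unfolding G_def p_def \<mu>_def by linarith
      qed
    qed
    have p_pos: "\<forall>\<^sub>F n in sequentially. p n > 0"
    proof -
      have "0 < \<eta> / 3" "\<eta> / 3 < \<eta> / 2" "\<eta> / 2 < \<eta>" using \<eta>0 by auto
      from lower[OF this] G_pos[of "\<eta> / 2"] show ?thesis
        using \<eta>0 \<eta>
      proof (elim eventually_elim2[rotated])
        fix n assume 1: "G (\<eta> / 2) n > 0" "G (\<eta> / 2) n / 3 \<le> p n * (\<eta> / 2) powr (\<eta> / 3 * \<mu> n)"
        then have "0 < p n * (\<eta> / 2) powr (\<eta> / 3 * \<mu> n)" by linarith
        then show "p n > 0" using \<eta>0 by (simp add: zero_less_mult_iff)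
      qed auto
    qed
    moreover have "(\<lambda>n. ln (p n) / V n) \<longlonglongrightarrow> L * (\<eta> - 1 - \<eta> * ln \<eta>)"
    proof (rule order_tendstoI)
      fix y assume y: "L * (\<eta> - 1 - \<eta> * ln \<eta>) < y"
      have "(\<lambda>n. ln (G \<eta> n) / V n - \<eta> * (\<mu> n / V n) * ln \<eta>) \<longlonglongrightarrow> L * (\<eta> - 1) - \<eta> * L * ln \<eta>"
        using \<eta> by (intro tendsto_intros G_lim \<mu>) auto
      moreover have "L * (\<eta> - 1) - \<eta> * L * ln \<eta> < y" using y by (simp add: algebra_simps)
      ultimately have "\<forall>\<^sub>F n in sequentially. ln (G \<eta> n) / V n - \<eta> * (\<mu> n / V n) * ln \<eta> < y"
        by (rule order_tendstoD(2))
      then show "\<forall>\<^sub>F n in sequentially. ln (p n) / V n < y"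
        using p_pos V_pos m_le
      proof eventually_elim
        case (elim n)
        have "p n * \<eta> powr (\<eta> * \<mu> n) \<le> G \<eta> n"
          using lower_tail_upper[OF elim(4) \<eta>0 \<eta>(2)] by (simp add: p_def \<mu>_def G_def)
        then have "ln (p n * \<eta> powr (\<eta> * \<mu> n)) \<le> ln (G \<eta> n)"
          using elim \<eta>0 by (intro ln_mono) (auto intro: mult_pos_pos order.strict_trans2)
        then have "ln (p n) \<le> ln (G \<eta> n) - \<eta> * \<mu> n * ln \<eta>"
          using elim \<eta>0 by (simp add: ln_mult_pos ln_powr)
        then have "ln (p n) / V n \<le> (ln (G \<eta> n) - \<eta> * \<mu> n * ln \<eta>) / V n"
          using elim by (intro divide_right_mono) auto
        also have "\<dots> = ln (G \<eta> n) / V n - \<eta> * (\<mu> n / V n) * ln \<eta>" by (simp add: diff_divide_distrib)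
        finally show ?case using elim by linarith
      qed
    next
      fix y assume y: "y < L * (\<eta> - 1 - \<eta> * ln \<eta>)"
      \<comment> \<open>The rate obtained from the tilt \<open>\<eta> * (1 - \<delta>)\<close> with
        lower cutoff \<open>\<eta> * (1 - 2 * \<delta>)\<close>; it tends to the desired value as
        \<delta> tends to 0.\<close>
      define f where "f = (\<lambda>\<delta>. L * (\<eta> * (1 - \<delta>) - 1) - \<eta> * (1 - 2 * \<delta>) * L * ln (\<eta> * (1 - \<delta>)))"
      have "(f \<longlongrightarrow> L * (\<eta> * (1 - 0) - 1) - \<eta> * (1 - 2 * 0) * L * ln (\<eta> * (1 - 0))) (at_right 0)"
        unfolding f_def using \<eta>0 by (intro tendsto_intros) auto
      moreover have "L * (\<eta> * (1 - 0) - 1) - \<eta> * (1 - 2 * 0) * L * ln (\<eta> * (1 - 0)) > y"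
        using y by (simp add: algebra_simps)
      ultimately have "\<forall>\<^sub>F \<delta> in at_right 0. f \<delta> > y" by (rule order_tendstoD(1))
      moreover have "\<forall>\<^sub>F \<delta> in at_right 0. 0 < \<delta> \<and> \<delta> < (1/2 :: real)"
        by (simp add: eventually_at_right[of 0 1]) (rule exI[of _ "1/2"], simp)
      ultimately have "\<forall>\<^sub>F \<delta> in at_right 0. f \<delta> > y \<and> 0 < \<delta> \<and> \<delta> < 1/2" by (rule eventually_conj)
      then obtain \<delta> where \<delta>: "f \<delta> > y" "0 < \<delta>" "\<delta> < 1/2"
        using eventually_happens'[of "at_right (0::real)"] by fastforce
      define \<sigma> where "\<sigma> = \<eta> * (1 - \<delta>)"
      define \<beta> where "\<beta> = \<eta> * (1 - 2 * \<delta>)"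
      have *: "0 < \<beta>" "\<beta> < \<sigma>" "\<sigma> < \<eta>" using \<eta>0 \<delta> by (simp_all add: \<sigma>_def \<beta>_def)
      have "(\<lambda>n. ln (G \<sigma> n) / V n - ln 3 / V n - \<beta> * (\<mu> n / V n) * ln \<sigma>) \<longlonglongrightarrow> L * (\<sigma> - 1) - 0 - \<beta> * L * ln \<sigma>"
        using * \<eta> by (intro tendsto_intros G_lim \<mu> real_tendsto_divide_at_top[OF tendsto_const V]) auto
      moreover have "y < L * (\<sigma> - 1) - 0 - \<beta> * L * ln \<sigma>" using \<delta> by (simp add: f_def \<sigma>_def \<beta>_def)
      ultimately have "\<forall>\<^sub>F n in sequentially. y < ln (G \<sigma> n) / V n - ln 3 / V n - \<beta> * (\<mu> n / V n) * ln \<sigma>"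
        by (rule order_tendstoD(1))
      moreover have "\<forall>\<^sub>F n in sequentially. G \<sigma> n > 0" using * \<eta> by (intro G_pos) auto
      ultimately show "\<forall>\<^sub>F n in sequentially. y < ln (p n) / V n"
        using p_pos V_pos lower[OF *]
      proof eventually_elim
        case (elim n)
        have "ln (G \<sigma> n / 3) \<le> ln (p n * \<sigma> powr (\<beta> * \<mu> n))"
          using elim by (intro ln_mono) auto
        then have "ln (G \<sigma> n) - ln 3 - \<beta> * \<mu> n * ln \<sigma> \<le> ln (p n)"
          using elim * by (simp add: ln_mult_pos ln_powr ln_divide_pos)
        then have "(ln (G \<sigma> n) - ln 3 - \<beta> * \<mu> n * ln \<sigma>) / V n \<le> ln (p n) / V n"
          using elim by (intro divide_right_mono) auto
        then show ?case using elim by (simp add: diff_divide_distrib)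
      qed
    qed
    ultimately show ?thesis by blast
  qed
  then show "\<forall>\<^sub>F n in sequentially. lower_tail_prob \<eta> n (edge_count b n) > 0"
    and "(\<lambda>n. ln (lower_tail_prob \<eta> n (edge_count b n)) / real n powr (3/2))
      \<longlonglongrightarrow> b ^ 3 / 6 * (\<eta> - 1 - \<eta> * ln \<eta>)"
    by (simp_all add: p_def V_def L_def)
qed

section \<open>The lower tail for large \<open>b\<close> and non-analyticity\<close>

text \<open>The quotient of the binomials is a product of \<open>m\<close> factors
  \<open>(a - i) / (N - i)\<close>, each at least \<open>d / N\<close>; here the denominators are
  cleared.\<close>

lemma binomial_ratio_ge:
  assumes "d + m \<le> a" "a \<le> N"
  shows "d ^ m * (N choose m) \<le> N ^ m * (a choose m :: nat)"
  using assms(1)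
proof (induction m)
  case (Suc m)
  have IH: "d ^ m * (N choose m) \<le> N ^ m * (a choose m)" using Suc by simp
  have "Suc m * (d ^ Suc m * (N choose Suc m)) = d ^ Suc m * (Suc m * (N choose Suc m))"
    by (simp only: mult.left_commute)
  also have "\<dots> = d * (N - m) * (d ^ m * (N choose m))" by (simp only: Suc_binomial power_Suc mult_ac)
  also have "\<dots> \<le> (a - m) * N * (N ^ m * (a choose m))"
    using Suc.prems by (intro mult_mono IH) auto
  also have "\<dots> = N ^ Suc m * (Suc m * (a choose Suc m))" by (simp only: Suc_binomial power_Suc mult_ac)
  also have "\<dots> = Suc m * (N ^ Suc m * (a choose Suc m))" by (simp only: mult.left_commute)
  finally show ?case by (simp only: mult_le_cancel1)
qed simp

text \<open>Subgraphs of the complete bipartite graph between \<open>{..<h}\<close> and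
  \<open>{h..<n}\<close> have no triangles, so they lie in the event whatever the mean is.\<close>

lemma lower_tail_prob_bipartite:
  assumes m: "m \<le> card (nsets {..<n} 2)" and "h \<le> n" and \<eta>: "0 \<le> \<eta>"
  shows "real (h * (n - h) choose m) / real (card (nsets {..<n} 2) choose m) \<le> lower_tail_prob \<eta> n m"
proof -
  define D where "D = (\<lambda>(x, y). {x, y}) ` ({..<h} \<times> {h..<n})"
  have inj: "inj_on (\<lambda>(x, y). {x, y}) ({..<h} \<times> {h..<n})"
    by (auto simp: inj_on_def doubleton_eq_iff)
  have card_D: "card D = h * (n - h)" unfolding D_def by (simp add: card_image[OF inj])
  have fin_D: "finite D" by (simp add: D_def)
  have D_sub: "D \<subseteq> nsets {..<n} 2" using \<open>h \<le> n\<close> by (auto simp: D_def)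
  have cross: "(x < h) \<noteq> (y < h)" if "{x, y} \<in> D" for x y
    using that by (auto simp: D_def doubleton_eq_iff)
  have no_triangle: "triangles n G = 0" if "G \<subseteq> D" for G
  proof -
    have "\<not> nsets T 2 \<subseteq> G" if T: "T \<in> nsets {..<n} 3" for T
    proof
      assume *: "nsets T 2 \<subseteq> G"
      obtain x y z where xyz: "T = {x, y, z}" "x \<noteq> y" "x \<noteq> z" "y \<noteq> z"
        using T by (auto simp: nsets_def card_3_iff)
      then have "{x, y} \<in> nsets T 2" "{x, z} \<in> nsets T 2" "{y, z} \<in> nsets T 2" by auto
      then have "{x, y} \<in> D" "{x, z} \<in> D" "{y, z} \<in> D" using * \<open>G \<subseteq> D\<close> by blast+
      then show False using cross by blast
    qed
    then have "{T \<in> nsets {..<n} 3. nsets T 2 \<subseteq> G} = {}" by blast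
    then show ?thesis by (simp only: triangles_def card.empty)
  qed
  define \<mu> where "\<mu> = measure_pmf.expectation (Gnm n m) (\<lambda>G. real (triangles n G))"
  have \<mu>: "0 \<le> \<eta> * \<mu>" unfolding \<mu>_def using \<eta> by (intro mult_nonneg_nonneg Bochner_Integration.integral_nonneg) auto
  have "(h * (n - h) choose m) = card {G. G \<subseteq> D \<and> card G = m}"
    using fin_D by (simp add: n_subsets card_D)
  also have "{G. G \<subseteq> D \<and> card G = m} = {G \<in> graphs n m. G \<subseteq> D}"
    using D_sub by (auto simp: graphs_def)
  also have "real (card \<dots>) = (\<Sum>G\<in>graphs n m. of_bool (G \<subseteq> D))"
    by (simp add: finite_graphs Int_def)
  also have "\<dots> \<le> (\<Sum>G\<in>graphs n m. of_bool (real (triangles n G) \<le> \<eta> * \<mu>))"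
    using \<mu> by (intro sum_mono) (auto simp: no_triangle)
  finally have "real (h * (n - h) choose m) / real (card (graphs n m))
      \<le> (\<Sum>G\<in>graphs n m. of_bool (real (triangles n G) \<le> \<eta> * \<mu>)) / real (card (graphs n m))"
    by (intro divide_right_mono) auto
  then show ?thesis
    unfolding lower_tail_prob_def prob_Gnm expectation_Gnm[OF m] \<mu>_def card_graphs by simp
qed

text \<open>The balanced bipartite graph has about half of all \<open>N\<close> edges and
  \<open>m\<close> is of lower order, so \<open>a - m\<close> is at least \<open>N / 4\<close> and
  each factor in \<open>binomial_ratio_ge\<close> is at least 1/4.\<close>

lemma lower_tail_prob_ge:
  assumes b: "b > 0" and \<eta>: "0 \<le> \<eta>"
  shows "\<forall>\<^sub>F n in sequentially. (1/4) ^ edge_count b n \<le> lower_tail_prob \<eta> n (edge_count b n)"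
proof -
  \<comment> \<open>The right-hand side will be a lower bound for \<open>4 * a\<close>, whence
    \<open>N + 4 * m \<le> 4 * a\<close>.\<close>
  have "\<forall>\<^sub>F n in sequentially. real n * (real n - 1) / 2 + 4 * (b * real n powr (3/2) / 2) \<le> (real n)\<^sup>2 - 1"
    using b by real_asymp
  moreover have "\<forall>\<^sub>F n in sequentially. b * real n powr (3/2) / 2 \<le> real n * (real n - 1) / 2"
    using b by real_asymp
  ultimately show ?thesis using eventually_ge_at_top[of 2]
  proof eventually_elim
    case (elim n)
    define m where "m = edge_count b n"
    define h where "h = n div 2"
    define N where "N = card (nsets {..<n} 2)"
    define a where "a = h * (n - h)"
    have N: "real N = real n * (real n - 1) / 2" unfolding N_def by (rule card_edges)
    have m: "real m \<le> b * real n powr (3/2) / 2" using edge_count_bounds(1)[OF b] by (simp add: m_def)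
    have mN: "m \<le> N" using m N elim by linarith
    have a_ge: "(real n)\<^sup>2 - 1 \<le> 4 * real a"
    proof -
      have "n = 2 * h \<or> n = 2 * h + 1" unfolding h_def by presburger
      then show ?thesis by (auto simp: a_def power2_eq_square algebra_simps)
    qed
    have "real (N + 4 * m) \<le> real (4 * a)" using a_ge elim m N by simp
    then have am: "N + 4 * m \<le> 4 * a" by (simp only: of_nat_le_iff)
    define d where "d = a - m"
    have d: "d + m \<le> a" "N \<le> 4 * d" using am by (simp_all add: d_def)
    have aN: "a \<le> N"
    proof -
      have "real a \<le> real N"
      proof -
        have h1: "real h * 1 \<le> real h * real h"
          using elim by (intro mult_left_mono) (auto simp: h_def)
        have "n = 2 * h \<or> n = 2 * h + 1" unfolding h_def by presburger
        then show ?thesis unfolding N a_def using h1 by (auto simp: algebra_simps)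
      qed
      then show ?thesis by simp
    qed
    have "N ^ m * (N choose m) \<le> (4 * d) ^ m * (N choose m)"
      using d by (intro mult_right_mono power_mono) auto
    also have "\<dots> = 4 ^ m * (d ^ m * (N choose m))" by (simp add: power_mult_distrib)
    also have "\<dots> \<le> 4 ^ m * (N ^ m * (a choose m))"
      using binomial_ratio_ge[OF d(1) aN] by simp
    finally have "N ^ m * (N choose m) \<le> N ^ m * (4 ^ m * (a choose m))" by (simp add: mult_ac)
    moreover have "N > 0"
      using aN by (rule less_le_trans[rotated]) (use elim in \<open>simp add: a_def h_def\<close>)
    ultimately have "(N choose m) \<le> 4 ^ m * (a choose m)" by simp
    then have "real (N choose m) \<le> 4 ^ m * real (a choose m)" by (metis of_nat_le_iff of_nat_mult of_nat_numeral of_nat_power)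
    moreover have "real (N choose m) > 0" using mN by simp
    ultimately have "(1/4) ^ m \<le> real (a choose m) / real (N choose m)"
      by (simp add: field_simps power_divide)
    also have "\<dots> \<le> lower_tail_prob \<eta> n m"
      unfolding a_def N_def using mN \<eta> by (intro lower_tail_prob_bipartite) (auto simp: h_def N_def)
    finally show ?case by (simp add: m_def)
  qed
qed

text \<open>A bound linear in \<open>b\<close>, valid on the whole half-line; a negative cubic must
  eventually violate it.\<close>

lemma phi_hat_ereal_ge:
  assumes b: "b > 0" and \<eta>: "0 \<le> \<eta>"
  shows "ereal (- (b * ln 4 / 2)) \<le> phi_hat_ereal \<eta> b"
  unfolding phi_hat_ereal_def
proof (rule Liminf_bounded)
  show "\<forall>\<^sub>F n in sequentially. ereal (- (b * ln 4 / 2))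
      \<le> ereal (1 / real n powr (3/2)) * log_prob (lower_tail_prob \<eta> n (edge_count b n))"
    using lower_tail_prob_ge[OF assms] eventually_gt_at_top[of 0]
  proof eventually_elim
    case (elim n)
    define p where "p = lower_tail_prob \<eta> n (edge_count b n)"
    have p: "p > 0" using elim(1) unfolding p_def by (rule less_le_trans[rotated]) simp
    have V: "real n powr (3/2) > 0" using elim by simp
    have "ln ((1/4) ^ edge_count b n) \<le> ln p" using elim(1) p by (simp add: p_def)
    then have "- (real (edge_count b n) * ln 4) \<le> ln p" by (simp add: ln_realpow ln_div)
    moreover have "real (edge_count b n) * ln 4 \<le> b * real n powr (3/2) / 2 * ln 4"
      using edge_count_bounds(1)[OF b, of n] by (intro mult_right_mono) auto
    ultimately have "- (b * real n powr (3/2) / 2 * ln 4) \<le> ln p" by linarith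
    then have "- (b * ln 4 / 2) \<le> 1 / real n powr (3/2) * ln p" using V by (simp add: field_simps)
    then show ?case using p by (simp add: log_prob_def flip: p_def)
  qed
qed

lemma phi_hat_ereal_le_0: "phi_hat_ereal \<eta> b \<le> 0"
  unfolding phi_hat_ereal_def
proof (rule Liminf_le)
  have "log_prob (lower_tail_prob \<eta> n m) \<le> 0" for n m
    by (auto simp: log_prob_def lower_tail_prob_def less_le)
  then have "ereal (1 / real n powr (3/2)) * log_prob (lower_tail_prob \<eta> n (edge_count b n)) \<le> 0" for n
    by (simp add: ereal_mult_le_0_iff)
  then show "\<forall>\<^sub>F n in sequentially. ereal (1 / real n powr (3/2)) * log_prob (lower_tail_prob \<eta> n (edge_count b n)) \<le> 0"
    by simp
qed simp

lemma phi_hat_ereal_finite: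
  assumes "b > 0" "0 \<le> \<eta>"
  shows "\<bar>phi_hat_ereal \<eta> b\<bar> \<noteq> \<infinity>"
  using phi_hat_ereal_ge[OF assms] phi_hat_ereal_le_0[of \<eta> b] by auto

lemma phi_hat_small:
  assumes b: "0 < b" "b \<le> 1/20" and \<eta>: "0 \<le> \<eta>" "\<eta> < 1"
  shows "phi_hat \<eta> b = b ^ 3 / 6 * (\<eta> - 1 - \<eta> * ln \<eta>)"
proof -
  let ?p = "\<lambda>n. lower_tail_prob \<eta> n (edge_count b n)"
  have "(\<lambda>n. ereal (ln (?p n) / real n powr (3/2))) \<longlonglongrightarrow> ereal (b ^ 3 / 6 * (\<eta> - 1 - \<eta> * ln \<eta>))"
    using lower_tail_asymptotics(2)[OF assms] by simp
  moreover have "\<forall>\<^sub>F n in sequentially. ereal (ln (?p n) / real n powr (3/2)) = ereal (1 / real n powr (3/2)) * log_prob (?p n)"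
    using lower_tail_asymptotics(1)[OF assms] by eventually_elim (simp add: log_prob_def)
  ultimately have "(\<lambda>n. ereal (1 / real n powr (3/2)) * log_prob (?p n)) \<longlonglongrightarrow> ereal (b ^ 3 / 6 * (\<eta> - 1 - \<eta> * ln \<eta>))"
    by (rule Lim_transform_eventually)
  then have "phi_hat_ereal \<eta> b = ereal (b ^ 3 / 6 * (\<eta> - 1 - \<eta> * ln \<eta>))"
    unfolding phi_hat_ereal_def by (intro lim_imp_Liminf) auto
  then show ?thesis by (simp add: phi_hat_def)
qed

text \<open>Zeros are isolated: dividing by \<open>h ^ n\<close>, with \<open>n\<close> the order of
  vanishing, leaves a function that is continuous and nonzero at 0.\<close>

lemma fps_expansion_eventually_nonzero:
  fixes f :: "real \<Rightarrow> real"
  assumes f: "f has_fps_expansion F" and "F \<noteq> 0"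
  shows "\<forall>\<^sub>F h in at 0. f h \<noteq> 0"
proof -
  define n where "n = subdegree F"
  define c where "c = fps_nth F n"
  define g where "g = (\<lambda>x. if x = 0 then c else f x / x ^ n)"
  have c: "c \<noteq> 0" using \<open>F \<noteq> 0\<close> by (simp add: c_def n_def)
  have "g has_fps_expansion fps_shift n F"
    unfolding g_def by (rule has_fps_expansion_shift[OF f]) (simp_all add: n_def c_def)
  then have "isCont g 0" using has_fps_expansion_imp_continuous by blast
  then have "(g \<longlongrightarrow> c) (at 0)" by (simp add: isCont_def g_def)
  then have "\<forall>\<^sub>F h in at 0. g h \<noteq> 0" using c by (rule tendsto_imp_eventually_ne)
  moreover have "\<forall>\<^sub>F h in at 0. h \<noteq> (0 :: real)" by (rule eventually_neq_at_within)
  ultimately show ?thesis by eventually_elim (auto simp: g_def)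
qed

text \<open>The identity theorem on the half-line. At the supremum \<open>t\<close> of the initial
  intervals of agreement, the difference vanishes to the left of \<open>t\<close>; hence its
  expansion is 0, and the agreement extends beyond \<open>t\<close>.\<close>

lemma real_analytic_cubic_extension:
  assumes an: "\<And>x. x > 0 \<Longrightarrow> real_analytic_at f x" and "\<delta> > 0"
    and eq: "\<And>x. 0 < x \<Longrightarrow> x \<le> \<delta> \<Longrightarrow> f x = c * x ^ 3" and "x > 0"
  shows "f x = c * x ^ 3"
proof (rule ccontr)
  assume neq: "f x \<noteq> c * x ^ 3"
  define S where "S = {t. 0 < t \<and> (\<forall>y. 0 < y \<and> y \<le> t \<longrightarrow> f y = c * y ^ 3)}"
  have bound: "t \<le> x" if "t \<in> S" for t
    using that neq \<open>x > 0\<close> by (force simp: S_def not_le)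
  have "\<delta> \<in> S" using eq \<open>\<delta> > 0\<close> by (auto simp: S_def)
  define t where "t = Sup S"
  have bdd: "bdd_above S" using bound by (auto simp: bdd_above_def)
  have t: "\<delta> \<le> t" unfolding t_def using \<open>\<delta> \<in> S\<close> bdd by (rule cSup_upper)
  have below: "f y = c * y ^ 3" if "0 < y" "y < t" for y
  proof -
    obtain u where "u \<in> S" "y < u"
      using \<open>y < t\<close> \<open>\<delta> \<in> S\<close> bdd unfolding t_def by (subst (asm) less_cSup_iff) auto
    then show ?thesis using that by (auto simp: S_def)
  qed
  have "t > 0" using t \<open>\<delta> > 0\<close> by simp
  then obtain F where F: "(\<lambda>h. f (t + h)) has_fps_expansion F"
    using an by (auto simp: real_analytic_at_def)
  define D where "D = F - fps_const c * ((fps_const t + fps_X) * (fps_const t + fps_X) * (fps_const t + fps_X))"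
  have D: "(\<lambda>h. f (t + h) - c * (t + h) ^ 3) has_fps_expansion D"
    unfolding D_def power3_eq_cube by (intro fps_expansion_intros F)
  have "D = 0"
  proof (rule ccontr)
    assume "D \<noteq> 0"
    then have "\<forall>\<^sub>F h in at 0. f (t + h) - c * (t + h) ^ 3 \<noteq> 0"
      by (rule fps_expansion_eventually_nonzero[OF D])
    then obtain d where d: "d > 0" "\<And>h. h \<noteq> 0 \<Longrightarrow> \<bar>h\<bar> < d \<Longrightarrow> f (t + h) - c * (t + h) ^ 3 \<noteq> 0"
      by (auto simp: eventually_at dist_real_def)
    \<comment> \<open>A displacement to the left within the radius \<open>d\<close> that keeps
      \<open>t + h\<close> positive; there \<open>below\<close> forces a zero.\<close>
    define h where "h = - (min d t / 2)"
    have "h \<noteq> 0" "\<bar>h\<bar> < d" "0 < t + h" "t + h < t" using d(1) \<open>t > 0\<close> by (auto simp: h_def)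
    then show False using d(2)[of h] below[of "t + h"] by simp
  qed
  then have "\<forall>\<^sub>F h in nhds 0. f (t + h) - c * (t + h) ^ 3 = 0"
    using D by (auto simp: has_fps_expansion_def elim!: eventually_mono)
  then obtain d where d: "d > 0" "\<And>h. \<bar>h\<bar> < d \<Longrightarrow> f (t + h) = c * (t + h) ^ 3"
    by (auto simp: eventually_nhds_metric dist_real_def)
  have "f y = c * y ^ 3" if "0 < y" "y \<le> t + d / 2" for y
  proof (cases "y < t")
    case False
    then have "\<bar>y - t\<bar> < d" using that d(1) by auto
    then show ?thesis using d(2)[of "y - t"] by simp
  qed (use below that in blast)
  then have "t + d / 2 \<in> S" using \<open>t > 0\<close> d(1) by (auto simp: S_def)
  then have "t + d / 2 \<le> t" unfolding t_def using bdd by (rule cSup_upper)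
  then show False using d(1) by simp
qed

text \<open>The finiteness part shows that \<open>phi_hat\<close> is the genuine lower limit and
  never the default value 0 that \<open>real_of_ereal\<close> gives to infinities.\<close>

theorem corollary1p10:
  fixes \<eta> :: real
  assumes "0 \<le> \<eta>" and "\<eta> < 1"
  shows "(\<forall>b>0. \<bar>phi_hat_ereal \<eta> b\<bar> \<noteq> \<infinity>) \<and>
         (\<exists>b>0. \<not> real_analytic_at (phi_hat \<eta>) b)"
proof (intro conjI allI impI)
  show "\<bar>phi_hat_ereal \<eta> b\<bar> \<noteq> \<infinity>" if "b > 0" for b
    using that assms by (intro phi_hat_ereal_finite)
  show "\<exists>b>0. \<not> real_analytic_at (phi_hat \<eta>) b"
  proof (rule ccontr)
    assume "\<not> (\<exists>b>0. \<not> real_analytic_at (phi_hat \<eta>) b)"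
    then have an: "\<And>b. b > 0 \<Longrightarrow> real_analytic_at (phi_hat \<eta>) b" by blast
    \<comment> \<open>The rate for small \<open>b\<close> is \<open>- k * b ^ 3\<close>; that
      \<open>k\<close> is strictly positive relies on \<open>\<eta> < 1\<close>.\<close>
    define k where "k = (1 - \<eta> + \<eta> * ln \<eta>) / 6"
    have k: "k > 0"
    proof (cases "\<eta> = 0")
      case False
      then have "\<eta> > 0" using assms by simp
      then have "ln (1 / \<eta>) < 1 / \<eta> - 1" using assms by (intro ln_less_minus_one_strict) auto
      then have "\<eta> * ln (1 / \<eta>) < \<eta> * (1 / \<eta> - 1)" using \<open>\<eta> > 0\<close> by (rule mult_strict_left_mono)
      then show ?thesis using \<open>\<eta> > 0\<close> by (simp add: k_def ln_div right_diff_distrib)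
    qed (simp add: k_def)
    have small: "phi_hat \<eta> b = - k * b ^ 3" if "0 < b" "b \<le> 1/20" for b
      unfolding phi_hat_small[OF that assms] by (simp add: k_def field_simps)
    have cubic: "phi_hat \<eta> b = - k * b ^ 3" if "b > 0" for b
      using real_analytic_cubic_extension[OF an, of "1/20" "- k" b] small that by simp
    have linear: "- (b * ln 4 / 2) \<le> phi_hat \<eta> b" if "b > 0" for b
      using phi_hat_ereal_ge[OF that assms(1)] phi_hat_ereal_finite[OF that assms(1)]
      by (cases "phi_hat_ereal \<eta> b") (auto simp: phi_hat_def)
    \<comment> \<open>This \<open>b\<close> exceeds 1, so
      \<open>k * b\<^sup>2 \<ge> k * b = ln 4 + k\<close>, more than the \<open>ln 4 / 2\<close>
      that the linear bound allows.\<close>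
    define b where "b = ln 4 / k + 1"
    have b: "b > 1" using k by (simp add: b_def)
    have "k * b ^ 3 \<le> b * ln 4 / 2" using cubic[of b] linear[of b] b by simp
    then have "b * (k * b\<^sup>2) \<le> b * (ln 4 / 2)" by (simp add: power3_eq_cube power2_eq_square mult_ac)
    then have "k * b\<^sup>2 \<le> ln 4 / 2" using b by simp
    moreover have "k * b \<le> k * b\<^sup>2" using b k by (simp add: power2_eq_square)
    moreover have "k * b = ln 4 + k" using k by (simp add: b_def field_simps)
    moreover have "ln 4 > (0 :: real)" by simp
    ultimately show False using k by linarith
  qed
qed

end
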